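(* Let $p$ be an odd prime and let $k$ be a field of characteristic $p$. Let $f\in k[[\zeta]]$ be of the form $$f(\zeta)=\zeta\left(1+\sum_{j=2}^{+\infty}a_j\zeta^j\right).$$ Let $n\geq1$ be an integer, and put $$d:=\frac{p^n-1}{p-1},\qquad D:=pd+1=\frac{p^{n+1}-1}{p-1},\qquad \varphi:=\tfrac32a_2^3+a_3^2-a_2a_4,$$ $$\alpha_n:=a_2^{p^n-2d}\varphi^d,\qquad \beta_n:=\frac{a_3}{a_2}\,\alpha_n,\qquad \gamma_n:=-\left(\frac{3a_2}{2}-\frac{a_4}{a_2}\right)\alpha_n.$$ Then $$f^{p^n}(\zeta)-\zeta\equiv\alpha_n\zeta^{2D+1}+\beta_n\zeta^{2D+2}+\gamma_n\zeta^{2D+3}\mod\langle\zeta^{2D+4}\rangle.$$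
   Context: $f^{m}$ denotes the $m$-fold composition of $f$ with itself, and $\langle \zeta^{N}\rangle$ is the ideal of $k[[\zeta]]$ generated by $\zeta^N$. Since $p^n-2d\ge1$, the expressions $\beta_n$ and $\gamma_n$ are polynomials in $a_2,a_3,a_4$ (cancel the factor $a_2$ in the denominator against $\alpha_n$), and this is how they are understood when $a_2=0$. *)

theory Defs
  imports "HOL-Computational_Algebra.Computational_Algebra"
begin

definition fps_iterate :: "'a::comm_ring_1 fps \<Rightarrow> nat \<Rightarrow> 'a fps" where
  "fps_iterate f m = ((\<lambda>g. f oo g) ^^ m) fps_X"

definition d_exp :: "nat \<Rightarrow> nat \<Rightarrow> nat" where
  "d_exp p n = (p ^ n - 1) div (p - 1)"

definition D_exp :: "nat \<Rightarrow> nat \<Rightarrow> nat" where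
  "D_exp p n = p * d_exp p n + 1"

definition phi :: "(nat \<Rightarrow> 'a::field) \<Rightarrow> 'a" where
  "phi a = 3 / 2 * a 2 ^ 3 + a 3 ^ 2 - a 2 * a 4"

definition alpha :: "nat \<Rightarrow> nat \<Rightarrow> (nat \<Rightarrow> 'a::field) \<Rightarrow> 'a" where
  "alpha p n a = a 2 ^ (p ^ n - 2 * d_exp p n) * phi a ^ d_exp p n"

(* beta and gamma are a_3 / a_2 * alpha and - (3 a_2 / 2 - a_4 / a_2) * alpha, read as
   polynomials in a_2, a_3, a_4: one factor a_2 of alpha cancels the denominator a_2.  The
   cancellation is written out because division by 0 yields 0, so the quotients themselves
   would have the wrong value at a_2 = 0 when p^n - 2 d = 1.  See beta_conv_alpha and
   gamma_conv_alpha for the case a_2 \<noteq> 0. *)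

definition beta :: "nat \<Rightarrow> nat \<Rightarrow> (nat \<Rightarrow> 'a::field) \<Rightarrow> 'a" where
  "beta p n a = a 3 * (a 2 ^ (p ^ n - 2 * d_exp p n - 1) * phi a ^ d_exp p n)"

definition gamma :: "nat \<Rightarrow> nat \<Rightarrow> (nat \<Rightarrow> 'a::field) \<Rightarrow> 'a" where
  "gamma p n a =
     - (3 * a 2 / 2 * alpha p n a - a 4 * (a 2 ^ (p ^ n - 2 * d_exp p n - 1) * phi a ^ d_exp p n))"

lemma d_exp_mult:
  assumes "p \<ge> 2"
  shows "(p - 1) * d_exp p n = p ^ n - 1"
proof -
  have "int p - 1 dvd int p ^ n - 1 ^ n"
    by (metis dvd_triv_left power_diff_sumr2)
  hence "int (p - 1) dvd int (p ^ n - 1)"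
    using assms by (simp add: of_nat_diff)
  hence "p - 1 dvd p ^ n - 1"
    by (simp only: int_dvd_int_iff)
  thus ?thesis
    by (simp add: d_exp_def)
qed

lemma D_exp_altdef:
  assumes "p \<ge> 2"
  shows "D_exp p n = (p ^ (n + 1) - 1) div (p - 1)"
proof -
  have "(p - 1) * D_exp p n = p * ((p - 1) * d_exp p n) + (p - 1)"
    by (simp add: D_exp_def algebra_simps)
  also have "\<dots> = p * (p ^ n - 1) + (p - 1)"
    by (simp only: d_exp_mult[OF assms])
  also have "\<dots> = p ^ (n + 1) - 1"
    using assms by (simp add: right_diff_distrib')
  finally have "(p - 1) * D_exp p n = p ^ (n + 1) - 1" .
  thus ?thesis
    using assms by (metis diff_is_0_eq nonzero_mult_div_cancel_left not_less_eq_eq numeral_2_eq_2 One_nat_def)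
qed

lemma alpha_exponent_pos:
  assumes "p \<ge> 3"
  shows "p ^ n - 2 * d_exp p n \<ge> 1"
proof -
  have "2 * d_exp p n \<le> (p - 1) * d_exp p n"
    using assms by (intro mult_right_mono) auto
  moreover have "p ^ n \<ge> 1"
    using assms by simp
  moreover have "(p - 1) * d_exp p n = p ^ n - 1"
    using assms by (intro d_exp_mult) simp
  ultimately show ?thesis
    by linarith
qed

lemma alpha_conv:
  assumes "p \<ge> 3"
  shows "alpha p n a = a 2 * (a 2 ^ (p ^ n - 2 * d_exp p n - 1) * phi a ^ d_exp p n)"
proof -
  have "a 2 ^ (p ^ n - 2 * d_exp p n) = a 2 * a 2 ^ (p ^ n - 2 * d_exp p n - 1)"
    by (rule power_eq_if[THEN trans]) (use alpha_exponent_pos[OF assms, of n] in simp)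
  thus ?thesis
    by (simp add: alpha_def)
qed

lemma beta_conv_alpha:
  assumes "p \<ge> 3" "a 2 \<noteq> 0"
  shows "beta p n a = a 3 / a 2 * alpha p n a"
  using assms by (simp add: beta_def alpha_conv)

lemma gamma_conv_alpha:
  assumes "p \<ge> 3" "a 2 \<noteq> 0"
  shows "gamma p n a = - (3 * a 2 / 2 - a 4 / a 2) * alpha p n a"
  using assms by (simp add: gamma_def alpha_conv left_diff_distrib)

end

theory Submission
  imports Defs "HOL-Number_Theory.Residues"
begin

text \<open>
  Fix a power series $g = \zeta + \dots$ with $g - \zeta$ of order $q + 1$. Composition with $g$
  is a ring endomorphism $F$ of $k[[\zeta]]$; let $T = F - 1$ (\<^term>\<open>comp_diff\<close>). In
  characteristic $p$ one has $F^p - 1 = (F - 1)^p$, so that $h \circ g^p - h = T^p h$ for every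
  $h$: the $p$-th iterate is found by applying $T$ to one series $p$ times. Each application
  raises the order by at least $q$, and $T \zeta^m = m b_0 \zeta^{m+q} + \dots$ when
  $g = \zeta + b_0 \zeta^{q+1} + b_1 \zeta^{q+2} + b_2 \zeta^{q+3} + \dots$. If $q$ is prime
  to $p$, one of the exponents $m, m + q, \dots, m + (p - 1) q$ is divisible by $p$, the leading
  terms cancel, and $g^p$ is closer to the identity than the order of $g - \zeta$ suggests.

  Everything follows from one step (\<^emph>\<open>iterate_CHAR_step\<close>). Suppose $q \equiv 2$ modulo $p$,
  and let $b_2' = b_2$ if $q > 2$ and $b_2' = b_2 - \frac32 b_0^2$ if $q = 2$. Then
  \[ g^p \equiv \zeta + \mu \zeta^{pq+3} (b_0 + b_1 \zeta + b_2' \zeta^2) \mod \zeta^{pq+6},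
     \qquad \mu = b_0^{p-3} (b_1^2 - b_0 b_2'). \]
  The triple of coefficients is thus only multiplied by a scalar, up to the correction at $q = 2$,
  which is where the term $\frac32 a_2^3$ of $\varphi$ comes from: with
  $b_2' = a_4 - \frac32 a_2^2$ one has $\varphi = a_3^2 - a_2 b_2'$. As
  $pq + 2 \equiv 2$ modulo $p$ again, the step can be repeated, and the exponents of $a_2$ and
  $\varphi$ accumulate to $p^n - 2d - 1$ and $d$.

  For $b_0 \neq 0$ the step is computed in the coordinate $x = \zeta + c \zeta^2$, $c = b_1 / b_0$,
  which removes the term after the leading one:
  $T x^m = m b_0 x^{m+q} + e(m) x^{m+q+2} + \dots$ (\<^emph>\<open>comp_diff_straightening_power\<close>). The
  operator is applied to $x^{p-2}$, a substitute for $x^{-2}$, because $x^{-q}$ is, up to a constant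
  factor, the leading term of the time coordinate of the flow that $g$ approximates, and powers of
  $x^p$ are left almost unchanged by $g$. With $P = p - 2 + q$, a multiple
  of $p$,
  \[ T x^{p-2} = -2 b_0 x^P + \kappa x^{P+2} + k_3 x^{P+3} + k_4 x^{P+4} + \dots . \]
  Now apply $T^{p-1}$. The series $x^P$ is a $p$-th power, $T$ commutes with $p$-th powers, and so
  its contribution has very high order. For $x^{P+3}$ and $x^{P+4}$ the exponents pass through a
  multiple of $p$ and the leading term disappears. Only $x^{P+2}$ is left, with factors
  $2, 4, \dots, 2(p-1)$, whose product is $-1$ by the theorems of Wilson and Fermat. This
  determines $x \circ g^p$, and from it $g^p$, to the required precision.

  For $b_0 = 0$ the order of $g - \zeta$ is at least $q + 2$. If $p \geq 5$, counting orders shows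
  that $g^p - \zeta$ vanishes to the required precision; if $p = 3$, three applications of $T$
  to $\zeta$ are computed directly.
\<close>

section \<open>Congruences modulo powers of the variable\<close>

definition fps_cong :: "nat \<Rightarrow> 'a::comm_ring_1 fps \<Rightarrow> 'a fps \<Rightarrow> bool" where
  "fps_cong N A B \<longleftrightarrow> fps_X ^ N dvd A - B"

lemma fps_cong_refl [simp]: "fps_cong N A A"
  by (simp add: fps_cong_def)

lemma fps_cong_sym: "fps_cong N A B \<Longrightarrow> fps_cong N B A"
  unfolding fps_cong_def by (metis dvd_minus_iff minus_diff_eq)

lemma fps_cong_trans [trans]: "fps_cong N A B \<Longrightarrow> fps_cong N B C \<Longrightarrow> fps_cong N A C"
  unfolding fps_cong_def using dvd_add by fastforce

lemma fps_cong_add: "fps_cong N A B \<Longrightarrow> fps_cong N C D \<Longrightarrow> fps_cong N (A + C) (B + D)"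
  unfolding fps_cong_def using dvd_add by (fastforce simp: algebra_simps)

lemma fps_cong_mult: "fps_cong N A B \<Longrightarrow> fps_cong N C D \<Longrightarrow> fps_cong N (A * C) (B * D)"
proof -
  assume "fps_cong N A B" "fps_cong N C D"
  moreover have "A * C - B * D = (A - B) * C + (C - D) * B"
    by (simp add: algebra_simps)
  ultimately show ?thesis
    unfolding fps_cong_def by (metis dvd_add dvd_mult2)
qed

lemma fps_cong_power: "fps_cong N A B \<Longrightarrow> fps_cong N (A ^ k) (B ^ k)"
  by (induction k) (auto intro: fps_cong_mult)

lemma fps_cong_mono: "fps_cong N A B \<Longrightarrow> M \<le> N \<Longrightarrow> fps_cong M A B"
  unfolding fps_cong_def using le_imp_power_dvd dvd_trans by blast

lemma fps_cong_scale: "fps_cong N A B \<Longrightarrow> fps_X ^ k dvd C \<Longrightarrow> fps_cong (k + N) (C * A) (C * B)"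
  unfolding fps_cong_def by (metis mult_dvd_mono power_add right_diff_distrib)

lemma fps_cong_0: "fps_cong N A 0 \<longleftrightarrow> fps_X ^ N dvd A"
  by (simp add: fps_cong_def)

lemma fps_cong_cancel_X:
  fixes A B :: "'a::idom fps"
  assumes "fps_cong (k + N) (fps_X ^ k * A) (fps_X ^ k * B)"
  shows "fps_cong N A B"
proof -
  have "fps_X ^ k * fps_X ^ N dvd fps_X ^ k * (A - B)"
    using assms by (simp add: fps_cong_def power_add right_diff_distrib)
  thus ?thesis
    by (simp add: fps_cong_def)
qed

lemma fps_cong_cancel_unit:
  fixes A B :: "'a::field fps"
  assumes "fps_cong N (w * A) (w * B)" "w $ 0 \<noteq> 0"
  shows "fps_cong N A B"
proof -
  have w: "inverse w * w = 1"
    using assms(2) by (simp add: inverse_mult_eq_1)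
  have "fps_cong N (inverse w * (w * A)) (inverse w * (w * B))"
    by (intro fps_cong_mult assms(1) fps_cong_refl)
  thus ?thesis
    by (simp add: w flip: mult.assoc)
qed

lemma fps_X_dvd_iff: "fps_X dvd (h :: 'a::comm_ring_1 fps) \<longleftrightarrow> h $ 0 = 0"
proof
  assume "h $ 0 = 0"
  hence "h = fps_X * fps_shift 1 h"
    by (simp add: fps_eq_iff)
  thus "fps_X dvd h" by (metis dvd_triv_left)
qed (auto simp: dvd_def)

text \<open>
  The expansion has to reach the quadratic term: for a series $u$ of order $2$ it contributes in
  degree $4$, the second degree after the leading one.
\<close>

lemma one_plus_power_expansion:
  fixes u :: "'a::comm_ring_1"
  shows "u ^ 3 dvd (1 + u) ^ m - (1 + of_nat m * u + of_nat (m choose 2) * u ^ 2)"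
proof (induction m)
  case 0
  show ?case by (simp add: numeral_2_eq_2)
next
  case (Suc m)
  then obtain R where R: "(1 + u) ^ m - (1 + of_nat m * u + of_nat (m choose 2) * u ^ 2) = u ^ 3 * R"
    by (auto simp: dvd_def)
  have c: "Suc m choose 2 = m + (m choose 2)"
    by (simp add: numeral_2_eq_2)
  have "(1 + u) ^ m = 1 + of_nat m * u + of_nat (m choose 2) * u ^ 2 + u ^ 3 * R"
    using R by (simp add: algebra_simps)
  hence "(1 + u) ^ Suc m - (1 + of_nat (Suc m) * u + of_nat (Suc m choose 2) * u ^ 2)
        = u ^ 3 * (R * (1 + u) + of_nat (m choose 2))"
    by (simp add: c algebra_simps power2_eq_square power3_eq_cube)
  thus ?case by (metis dvd_triv_left)
qed

section \<open>The difference operator of a composition\<close>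

definition comp_diff :: "'a::comm_ring_1 fps \<Rightarrow> 'a fps \<Rightarrow> 'a fps" where
  "comp_diff g h = (h oo g) - h"

lemma comp_diff_add: "comp_diff g (h + k) = comp_diff g h + comp_diff g k"
  by (simp add: comp_diff_def fps_compose_add_distrib)

lemma comp_diff_const_mult:
  fixes g :: "'a::idom fps"
  assumes "g $ 0 = 0"
  shows "comp_diff g (fps_const c * h) = fps_const c * comp_diff g h"
  by (simp add: comp_diff_def fps_compose_mult_distrib[OF assms] algebra_simps)

lemma funpow_comp_diff_add:
  "(comp_diff g ^^ j) (h + k) = (comp_diff g ^^ j) h + (comp_diff g ^^ j) k"
  by (induction j) (simp_all add: comp_diff_add)

lemma funpow_comp_diff_const_mult:
  fixes g :: "'a::idom fps"
  assumes "g $ 0 = 0"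
  shows "(comp_diff g ^^ j) (fps_const c * h) = fps_const c * (comp_diff g ^^ j) h"
  by (induction j) (simp_all add: comp_diff_const_mult[OF assms])

lemma fps_iterate_nth_0:
  "g $ 0 = 0 \<Longrightarrow> fps_iterate g m $ 0 = 0"
  by (induction m) (simp_all add: fps_iterate_def)

lemma fps_iterate_Suc: "fps_iterate g (Suc m) = g oo fps_iterate g m"
  by (simp add: fps_iterate_def)

lemma fps_iterate_add:
  fixes g :: "'a::idom fps"
  assumes "g $ 0 = 0"
  shows "fps_iterate g (m + k) = fps_iterate g m oo fps_iterate g k"
proof (induction m)
  case 0
  show ?case
    using fps_iterate_nth_0[OF assms, of k] by (simp add: fps_iterate_def[of _ 0])
next
  case (Suc m)
  thus ?case
    by (simp add: fps_iterate_Suc fps_compose_assoc fps_iterate_nth_0 assms)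
qed

lemma fps_iterate_mult:
  fixes g :: "'a::idom fps"
  assumes "g $ 0 = 0"
  shows "fps_iterate g (m * k) = fps_iterate (fps_iterate g m) k"
proof (induction k)
  case 0
  show ?case by (simp add: fps_iterate_def)
next
  case (Suc k)
  thus ?case by (simp add: fps_iterate_Suc fps_iterate_add[OF assms])
qed

text \<open>
  The binomial theorem for the composition operator, written as $F = 1 + T$; in this form no signs
  appear.
\<close>

lemma compose_fps_iterate:
  fixes g :: "'a::idom fps"
  assumes "g $ 0 = 0"
  shows "h oo fps_iterate g m = (\<Sum>k\<le>m. of_nat (m choose k) * (comp_diff g ^^ k) h)"
proof (induction m)
  case 0
  show ?case by (simp add: fps_iterate_def)
next
  case (Suc m)
  define T where "T k = (comp_diff g ^^ k) h" for k
  have T: "T k oo g = T k + T (Suc k)" for k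
    by (simp add: T_def comp_diff_def)
  have g1: "fps_iterate g 1 = g"
    by (simp add: fps_iterate_def)
  have "h oo fps_iterate g (Suc m) = (h oo fps_iterate g m) oo g"
    using fps_iterate_add[OF assms, of m 1]
    by (simp add: g1[unfolded One_nat_def] fps_compose_assoc fps_iterate_nth_0 assms)
  also have "\<dots> = (\<Sum>k\<le>m. of_nat (m choose k) * (T k + T (Suc k)))"
    by (simp add: Suc fps_compose_sum_distrib fps_compose_mult_distrib assms T
             flip: T_def fps_of_nat)
  also have "\<dots> = (\<Sum>k\<le>m. of_nat (m choose k) * T k) + (\<Sum>k\<le>m. of_nat (m choose k) * T (Suc k))"
    by (simp add: algebra_simps sum.distrib)
  also have "(\<Sum>k\<le>m. of_nat (m choose k) * T k) = T 0 + (\<Sum>k\<le>m. of_nat (m choose Suc k) * T (Suc k))"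
    using sum.atMost_Suc_shift[of "\<lambda>k. of_nat (m choose k) * T k" m] by (simp add: binomial_eq_0)
  also have "\<dots> + (\<Sum>k\<le>m. of_nat (m choose k) * T (Suc k))
     = (\<Sum>k\<le>Suc m. of_nat (Suc m choose k) * T k)"
    by (simp add: sum.atMost_Suc_shift sum.distrib algebra_simps del: sum.atMost_Suc)
  finally show ?case by (simp add: T_def)
qed

text \<open>
  In characteristic $p$ all binomial coefficients but the outer two vanish.
\<close>

lemma compose_fps_iterate_CHAR:
  fixes g :: "'a::idom fps"
  assumes "g $ 0 = 0" "prime p" "CHAR('a) = p"
  shows "h oo fps_iterate g p = h + (comp_diff g ^^ p) h"
proof -
  have p: "p > 0" using assms(2) prime_gt_0_nat by blast
  have "h oo fps_iterate g p = (\<Sum>k\<le>p. of_nat (p choose k) * (comp_diff g ^^ k) h)"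
    by (rule compose_fps_iterate[OF assms(1)])
  also have "\<dots> = (\<Sum>k\<in>{0,p}. of_nat (p choose k) * (comp_diff g ^^ k) h)"
  proof (intro sum.mono_neutral_right ballI)
    fix k assume "k \<in> {..p} - {0, p}"
    hence "p dvd (p choose k)"
      by (intro dvd_choose_prime) (use assms(2) in auto)
    hence "of_nat (p choose k) = (0 :: 'a fps)"
      by (simp add: of_nat_eq_0_iff_char_dvd assms(3))
    thus "of_nat (p choose k) * (comp_diff g ^^ k) h = 0" by simp
  qed auto
  finally show ?thesis using p by simp
qed

text \<open>
  Composition is multiplicative and $p$-th powers are additive, so taking $p$-th powers commutes
  with $T$. The point is the gain in order: $T^j (y^p)$ vanishes to $p$ times the order of $T^j y$,
  far beyond what $j$ applications of $T$ give for a general series of the order of $y^p$.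
\<close>

lemma comp_diff_frobenius:
  fixes g :: "'a::idom fps"
  assumes "g $ 0 = 0" "prime p" "CHAR('a) = p"
  shows "(comp_diff g ^^ j) (y ^ p) = ((comp_diff g ^^ j) y) ^ p"
proof -
  have fr: "(a + b) ^ p = a ^ p + b ^ p" for a b :: "'a fps"
    by (rule freshmans_dream) (simp_all add: assms)
  have diff: "comp_diff g (z ^ p) = (comp_diff g z) ^ p" for z
  proof -
    have "(z oo g) ^ p = (comp_diff g z) ^ p + z ^ p"
      by (subst fr[symmetric]) (simp add: comp_diff_def)
    thus ?thesis
      using fps_compose_power[OF assms(1), of z p] by (simp add: comp_diff_def)
  qed
  show ?thesis
    by (induction j) (simp_all add: diff)
qed

lemma comp_diff_order:
  fixes g :: "'a::idom fps"
  assumes g: "fps_X ^ Suc q dvd g - fps_X" and h: "fps_X ^ N dvd h"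
  shows "fps_X ^ (N + q) dvd comp_diff g h"
proof -
  obtain v where "g - fps_X = fps_X ^ Suc q * v" using g by (auto simp: dvd_def)
  hence gv: "g = fps_X * (1 + fps_X ^ q * v)" by (simp add: algebra_simps)
  hence g0: "g $ 0 = 0" by simp
  \<comment> \<open>A coefficient of degree below $q$ of $k \circ g$ involves only powers of $g$, and these agree
    with the powers of the variable in such degrees.\<close>
  have aux: "fps_X ^ q dvd comp_diff g k" for k
  proof -
    have "comp_diff g k $ n = 0" if "n < q" for n
    proof -
      have "fps_X ^ Suc q dvd g ^ i - fps_X ^ i" for i
        using g by (metis dvd_trans dvd_triv_left power_diff_sumr2)
      then obtain R where R: "g ^ i - fps_X ^ i = fps_X ^ Suc q * R i" for i
        unfolding dvd_def by metis
      have "(g ^ i - fps_X ^ i) $ n = 0" for i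
        using that by (simp only: R fps_X_power_mult_nth) simp
      hence "(g ^ i) $ n = (fps_X ^ i) $ n" for i
        by (metis eq_iff_diff_eq_0 fps_sub_nth)
      hence "(k oo g) $ n = (k oo fps_X) $ n"
        by (simp only: fps_compose_nth)
      thus ?thesis by (simp add: comp_diff_def)
    qed
    hence "comp_diff g k = fps_X ^ q * fps_shift q (comp_diff g k)"
      by (simp add: fps_eq_iff fps_X_power_mult_nth)
    thus ?thesis by (metis dvd_triv_left)
  qed
  obtain k where k: "h = fps_X ^ N * k" using h by (auto simp: dvd_def)
  have "fps_X ^ q * v dvd (1 + fps_X ^ q * v) ^ N - 1"
    by (metis add_diff_cancel_left' dvd_triv_left one_power2 power_diff_1_eq power_one)
  hence "fps_X ^ N * fps_X ^ q dvd fps_X ^ N * ((1 + fps_X ^ q * v) ^ N - 1)"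
    by (intro mult_dvd_mono) (auto dest: dvd_mult_left)
  also have "fps_X ^ N * ((1 + fps_X ^ q * v) ^ N - 1) = g ^ N - fps_X ^ N"
    by (simp only: gv power_mult_distrib right_diff_distrib mult_1_right)
  finally have 1: "fps_X ^ (N + q) dvd g ^ N - fps_X ^ N" by (simp add: power_add)
  have "fps_X ^ N oo g = g ^ N"
    using g0 fps_compose_power[OF g0, of fps_X N] by simp
  hence "comp_diff g h = (g ^ N - fps_X ^ N) * (k oo g) + fps_X ^ N * comp_diff g k"
    by (simp add: comp_diff_def k fps_compose_mult_distrib[OF g0] algebra_simps)
  thus ?thesis using 1 aux[of k]
    by (simp add: dvd_add mult_dvd_mono power_add)
qed

lemma funpow_comp_diff_order:
  fixes g :: "'a::idom fps"
  assumes "fps_X ^ Suc q dvd g - fps_X" "fps_X ^ N dvd h"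
  shows "fps_X ^ (N + j * q) dvd (comp_diff g ^^ j) h"
proof (induction j)
  case (Suc j)
  thus ?case using comp_diff_order[OF assms(1) Suc] by (simp add: algebra_simps)
qed (use assms in simp)

text \<open>
  If composition with $g$ multiplies $x$ by $1 + u$, it multiplies $x^m$ by $(1 + u)^m$. The effect of
  $T$ on all powers of a coordinate is thus known from the single series $u$.
\<close>

lemma comp_diff_power:
  fixes g :: "'a::idom fps"
  assumes g0: "g $ 0 = 0" and x: "x oo g = x * (1 + u)" "fps_X dvd x" and u: "fps_X ^ q dvd u"
  shows "fps_cong (m + 3 * q) (comp_diff g (x ^ m))
           (x ^ m * (of_nat m * u + of_nat (m choose 2) * u ^ 2))"
proof -
  have "comp_diff g (x ^ m) = x ^ m * ((1 + u) ^ m - 1)"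
    using fps_compose_power[OF g0, of x m]
    by (simp add: comp_diff_def x(1) power_mult_distrib right_diff_distrib)
  moreover have "fps_cong (3 * q) ((1 + u) ^ m - 1) (of_nat m * u + of_nat (m choose 2) * u ^ 2)"
  proof -
    have "fps_X ^ (3 * q) dvd u ^ 3"
      using u by (metis dvd_power_same mult.commute power_mult)
    thus ?thesis
      using one_plus_power_expansion[of u m] unfolding fps_cong_def
      by (metis (no_types, lifting) add.commute add.left_commute add_diff_cancel_left diff_add_eq_diff_diff_swap dvd_trans
           diff_diff_eq2 diff_diff_add)
  qed
  ultimately show ?thesis
    using x(2) by (metis dvd_power_same fps_cong_scale)
qed

lemma comp_diff_cong:
  fixes g :: "'a::idom fps"
  assumes "fps_X ^ Suc q dvd g - fps_X" "fps_cong N A B"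
  shows "fps_cong (N + q) (comp_diff g A) (comp_diff g B)"
proof -
  have "comp_diff g A = comp_diff g (A - B) + comp_diff g B"
    by (simp flip: comp_diff_add)
  thus ?thesis
    using comp_diff_order[OF assms(1), of N "A - B"] assms(2) by (simp add: fps_cong_def)
qed

lemma funpow_comp_diff_cong:
  fixes g :: "'a::idom fps"
  assumes "fps_X ^ Suc q dvd g - fps_X" "fps_cong N A B"
  shows "fps_cong (N + j * q) ((comp_diff g ^^ j) A) ((comp_diff g ^^ j) B)"
proof (induction j)
  case (Suc j)
  thus ?case using comp_diff_cong[OF assms(1) Suc] by (simp add: algebra_simps)
qed (use assms in simp)

text \<open>
  If $T x^m$ has no term next to its leading one, the same holds after every number of applications.
  The coefficient of the leading term is the product of the successive exponents, which is what
  makes it vanish as soon as one of them is divisible by the characteristic; the following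
  coefficient $C$ never needs to be known.
\<close>

lemma funpow_comp_diff_leading:
  fixes g :: "'a::idom fps"
  assumes g0: "g $ 0 = 0" and g: "fps_X ^ Suc q dvd g - fps_X" and x: "fps_X dvd x"
    and T: "\<And>m. fps_cong (m + q + 3) (comp_diff g (x ^ m))
              (fps_const (of_nat m * b) * x ^ (m + q) + fps_const (e m) * x ^ (m + q + 2))"
  shows "\<exists>C. fps_cong (m + j * q + 3) ((comp_diff g ^^ j) (x ^ m))
           (fps_const (b ^ j * (\<Prod>l<j. of_nat (m + l * q))) * x ^ (m + j * q)
            + fps_const C * x ^ (m + j * q + 2))"
proof (induction j)
  case 0
  show ?case by (rule exI[of _ 0]) simp
next
  case (Suc j)
  define M where "M = m + j * q"
  define A where "A = b ^ j * (\<Prod>l<j. of_nat (m + l * q))"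
  from Suc obtain C where C: "fps_cong (M + 3) ((comp_diff g ^^ j) (x ^ m))
      (fps_const A * x ^ M + fps_const C * x ^ (M + 2))"
    by (auto simp: M_def A_def)
  \<comment> \<open>The term with $C$ already has the highest degree that matters, so that only the leading term of
    its image survives.\<close>
  have "fps_cong (M + q + 3) ((comp_diff g ^^ Suc j) (x ^ m))
          (fps_const A * comp_diff g (x ^ M) + fps_const C * comp_diff g (x ^ (M + 2)))"
    using comp_diff_cong[OF g C]
    by (simp add: comp_diff_add comp_diff_const_mult[OF g0] add_ac del: power_Suc power_add_numeral2)
  also have "fps_cong (M + q + 3) \<dots>
      (fps_const A * (fps_const (of_nat M * b) * x ^ (M + q) + fps_const (e M) * x ^ (M + q + 2))
       + fps_const C * (fps_const (of_nat (M + 2) * b) * x ^ (M + q + 2)))"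
  proof (intro fps_cong_add fps_cong_mult fps_cong_refl T)
    have "fps_cong (M + 2 + q + 3) (comp_diff g (x ^ (M + 2)))
            (fps_const (of_nat (M + 2) * b) * x ^ (M + 2 + q) + fps_const (e (M + 2)) * x ^ (M + 2 + q + 2))"
      by (rule T)
    hence "fps_cong (M + q + 3) (comp_diff g (x ^ (M + 2)))
            (fps_const (of_nat (M + 2) * b) * x ^ (M + 2 + q) + fps_const (e (M + 2)) * x ^ (M + 2 + q + 2))"
      by (rule fps_cong_mono) simp
    also have "fps_cong (M + q + 3) \<dots> (fps_const (of_nat (M + 2) * b) * x ^ (M + 2 + q) + 0)"
    proof (intro fps_cong_add fps_cong_refl)
      have "fps_X ^ (M + 2 + q + 2) dvd x ^ (M + 2 + q + 2)"
        by (intro dvd_power_same x)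
      hence "fps_X ^ (M + q + 3) dvd x ^ (M + 2 + q + 2)"
        by (rule dvd_trans[rotated]) (rule le_imp_power_dvd, simp)
      thus "fps_cong (M + q + 3) (fps_const (e (M + 2)) * x ^ (M + 2 + q + 2)) 0"
        by (simp add: fps_cong_0)
    qed
    finally show "fps_cong (M + q + 3) (comp_diff g (x ^ (M + 2)))
                    (fps_const (of_nat (M + 2) * b) * x ^ (M + q + 2))"
      by (simp add: add_ac)
  qed
  also have "\<dots> = fps_const (A * (of_nat M * b)) * x ^ (M + q)
               + fps_const (A * e M + C * (of_nat (M + 2) * b)) * x ^ (M + q + 2)"
    by (simp add: algebra_simps flip: fps_const_mult fps_const_add)
  also have "A * (of_nat M * b) = b ^ Suc j * (\<Prod>l<Suc j. of_nat (m + l * q))"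
    by (simp add: A_def M_def algebra_simps)
  also have "M + q = m + Suc j * q"
    by (simp add: M_def)
  finally show ?case by blast
qed

section \<open>Straightening the map\<close>

lemma odd_prime_ge_3: "prime (p::nat) \<Longrightarrow> odd p \<Longrightarrow> p \<ge> 3"
  using prime_ge_2_nat[of p] by (cases "p = 2") auto

lemma two_neq_0_CHAR:
  assumes "prime p" "odd p" "CHAR('a::field) = p"
  shows "(2::'a) \<noteq> 0"
proof -
  have "\<not> p dvd 2" using odd_prime_ge_3[OF assms(1,2)] by (auto dest: dvd_imp_le)
  thus ?thesis
    using of_nat_eq_0_iff_char_dvd[where ?'a = 'a, of 2] assms(3) by simp
qed

text \<open>
  The product of the exponents $2, 4, \dots, 2(p-1)$ met by the one term that survives all $p - 1$
  applications of $T$.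
\<close>

lemma prod_even_CHAR:
  assumes "prime p" "odd p" "CHAR('a::field) = p"
  shows "(\<Prod>l<p-1. 2 + 2 * of_nat l :: 'a) = -1"
proof -
  have fact: "(of_nat (fact k) :: 'a) = (\<Prod>l<k. 1 + of_nat l)" for k
    by (induction k) (simp_all add: algebra_simps)
  have "[fact (p - 1) = -1] (mod int p)"
    using wilson_theorem[OF assms(1)] by simp
  hence "(of_int (fact (p - 1)) :: 'a) = of_int (-1)"
    by (simp only: of_int_eq_iff_cong_CHAR assms(3))
  hence w: "(of_nat (fact (p - 1)) :: 'a) = -1"
    by (metis of_int_1 of_int_minus of_int_of_nat_eq of_nat_fact)
  have "\<not> p dvd 2"
    using assms(1,2) by (metis primes_dvd_imp_eq two_is_prime_nat even_numeral dvd_refl)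
  hence "[2 ^ (p - 1) = 1] (mod p)"
    by (intro fermat_theorem assms)
  hence "(of_nat (2 ^ (p - 1)) :: 'a) = of_nat 1"
    by (simp only: of_nat_eq_iff_cong_CHAR assms(3))
  hence f: "(2 :: 'a) ^ (p - 1) = 1" by simp
  have "(\<Prod>l<p-1. 2 + 2 * of_nat l :: 'a) = (\<Prod>l<p-1. 2 * (1 + of_nat l))"
    by (simp add: algebra_simps)
  also have "\<dots> = 2 ^ (p - 1) * of_nat (fact (p - 1))"
    by (simp only: prod.distrib fact prod_constant card_lessThan)
  finally show ?thesis by (simp only: w f mult_1)
qed

lemma fps_expand_next:
  fixes x h :: "'a::comm_ring_1 fps"
  assumes x: "x = fps_X * w" "w $ 0 = 1" and h: "fps_X ^ N dvd h"
  obtains c where "fps_X ^ Suc N dvd h - fps_const c * x ^ N"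
proof -
  obtain k where k: "h = fps_X ^ N * k" using h by (auto simp: dvd_def)
  have "fps_X dvd k - fps_const (k $ 0) * w ^ N"
    by (simp add: fps_X_dvd_iff x(2) fps_power_zeroth)
  hence "fps_X ^ N * fps_X dvd fps_X ^ N * (k - fps_const (k $ 0) * w ^ N)"
    by (rule mult_dvd_mono[OF dvd_refl])
  also have "\<dots> = h - fps_const (k $ 0) * x ^ N"
    by (simp add: k x(1) power_mult_distrib algebra_simps)
  finally show ?thesis using that[of "k $ 0"] by (simp add: mult_ac)
qed

definition fps_quadratic :: "'a::comm_ring_1 \<Rightarrow> 'a \<Rightarrow> 'a \<Rightarrow> 'a fps" where
  "fps_quadratic b0 b1 b2 = fps_const b0 + fps_const b1 * fps_X + fps_const b2 * fps_X ^ 2"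

text \<open>
  In characteristic $p \geq 3$ the $p$-th power of $1 + c\zeta$ is $1 + c^p \zeta^p$. Powers of
  $x = \zeta (1 + c\zeta)$ can therefore be expanded to three terms knowing their exponents only
  modulo $p$.
\<close>

lemma fps_cong_linear_power_CHAR:
  assumes "prime p" "odd p" "CHAR('a::idom) = p"
  shows "fps_cong 3 ((1 + fps_const (c::'a) * fps_X) ^ (p * r)) 1"
proof -
  have p: "p \<ge> 3" by (rule odd_prime_ge_3[OF assms(1,2)])
  have "(1 + fps_const c * fps_X) ^ p = 1 ^ p + (fps_const c * fps_X) ^ p"
    by (rule freshmans_dream) (simp_all add: assms)
  hence "(1 + fps_const c * fps_X) ^ p - 1 = (fps_const c * fps_X) ^ p"
    by (simp only: power_one add_diff_cancel_left')
  moreover have "fps_X ^ 3 dvd (fps_const c * fps_X) ^ p"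
    using p by (auto simp: power_mult_distrib intro!: dvd_mult le_imp_power_dvd)
  ultimately have "fps_cong 3 ((1 + fps_const c * fps_X) ^ p) 1"
    by (simp only: fps_cong_def)
  from fps_cong_power[OF this, of r] show ?thesis
    by (simp add: power_mult)
qed

text \<open>
  With $w = 1 + CX$, $B_1 = C B_0$ and $C_2 = B_2 - C^2 B_0$, this compares the expansion
  $B_0 + C_2 X^2 w^2$ in the straightened coordinate with $B_0 + B_1 X + B_2 X^2$. The factor
  $1 + 2CX$ is the derivative of $X + C X^2$, and $w^3$ is what $w^N$ reduces to for exponents
  $N \equiv 3$ modulo $p$. The identity serves twice, for passing to the
  straightened coordinate and for coming back from it.
\<close>

lemma straightening_identity:
  fixes B0 B2 C X :: "'a::comm_ring_1"
  defines "w \<equiv> 1 + C * X"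
  shows "w ^ 3 * (B0 + (B2 - C ^ 2 * B0) * X ^ 2 * w ^ 2)
           - (B0 + C * B0 * X + B2 * X ^ 2) * (1 + 2 * C * X)
         = X ^ 3 * (B0 * C ^ 3 - 2 * C * B2 + (B2 - C ^ 2 * B0) * C * (1 + w + w ^ 2 + w ^ 3 + w ^ 4))"
  unfolding w_def by (simp add: eval_nat_numeral algebra_simps)

text \<open>
  Passing from $\zeta$ to the coordinate $x = \zeta + c \zeta^2$ changes the coefficient next to
  the leading one from $b_1$ to $b_1 - (q - 1) c b_0$, which is $b_1 - c b_0$ because $q \equiv 2$
  modulo $p$. With $c b_0 = b_1$ it disappears, and the following one becomes $b_2 - c^2 b_0$.
\<close>

lemma straightening_coordinate:
  fixes g :: "'a::field fps"
  assumes p: "prime p" "odd p" "CHAR('a) = p" and q: "q = p * r + 2"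
    and c: "c * b0 = b1"
    and g: "fps_cong (q + 4) g (fps_X + fps_X ^ (q + 1) * fps_quadratic b0 b1 b2)"
    and x: "x = fps_X * (1 + fps_const c * fps_X)"
  obtains u where "x oo g = x * (1 + u)" "fps_X ^ q dvd u"
    "fps_cong (q + 3) u (fps_const b0 * x ^ q + fps_const (b2 - c ^ 2 * b0) * x ^ (q + 2))"
proof -
  define C B0 B2 where "C = fps_const c" and "B0 = fps_const b0" and "B2 = fps_const b2"
  define Q where "Q = B0 + C * B0 * fps_X + B2 * fps_X ^ 2"
  define w where "w = 1 + C * fps_X"
  have Q: "Q = fps_quadratic b0 b1 b2"
    by (simp add: Q_def fps_quadratic_def C_def B0_def B2_def flip: c)
  obtain R where "g - (fps_X + fps_X ^ (q + 1) * Q) = fps_X ^ (q + 4) * R"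
    using g by (auto simp: fps_cong_def dvd_def Q)
  hence R: "g = fps_X + fps_X ^ (q + 1) * Q + fps_X ^ (q + 4) * R"
    by (simp add: algebra_simps)
  define v where "v = fps_X ^ q * (Q + fps_X ^ 3 * R)"
  have gv: "g = fps_X * (1 + v)"
    by (simp add: R v_def power_add power3_eq_cube algebra_simps numeral_eq_Suc)
  have w0: "w $ 0 \<noteq> 0" and w1: "w * inverse w = 1"
    by (simp_all add: w_def inverse_mult_eq_1')
  \<comment> \<open>Chosen so that $x \circ g = x (1 + u)$; the inverse of $w$ comes from cancelling $x = \zeta w$.\<close>
  define u where "u = v * (1 + 2 * C * fps_X + C * fps_X * v) * inverse w"
  have wu: "w * u = v * (1 + 2 * C * fps_X + C * fps_X * v)"
    using w1 by (simp add: u_def mult.left_commute)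
  have g0: "g $ 0 = 0" by (simp add: gv)
  have xw: "x = fps_X * w" by (simp add: x w_def C_def)
  have "x oo g = g * (1 + C * g)"
    using g0 by (simp add: x C_def fps_compose_mult_distrib fps_compose_add_distrib)
  also have "\<dots> = fps_X * (w + w * u)"
    unfolding wu unfolding gv w_def by (simp add: algebra_simps)
  finally have 1: "x oo g = x * (1 + u)"
    by (simp add: xw algebra_simps)
  have 2: "fps_X ^ q dvd u"
    by (simp add: u_def v_def mult.assoc)
  have 3: "fps_cong (q + 3) (w * u) (fps_X ^ q * (Q * (1 + 2 * C * fps_X)))"
  proof -
    have "w * u - fps_X ^ q * (Q * (1 + 2 * C * fps_X))
        = fps_X ^ q * (fps_X ^ 3 * R * (1 + 2 * C * fps_X)) + C * (fps_X * v ^ 2)"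
      unfolding wu unfolding v_def by (simp add: algebra_simps power2_eq_square)
    moreover have "fps_X ^ (q + 3) dvd fps_X ^ q * (fps_X ^ 3 * R * (1 + 2 * C * fps_X))"
      by (simp add: power_add mult.assoc)
    moreover have "fps_X ^ (q + 3) dvd fps_X * v ^ 2"
    proof -
      have "fps_X * v ^ 2 = fps_X ^ (1 + q * 2) * (Q + fps_X ^ 3 * R) ^ 2"
        by (simp add: v_def power_mult_distrib power_add flip: power_mult)
      moreover have "fps_X ^ (q + 3) dvd (fps_X ^ (1 + q * 2) :: 'a fps)"
        by (rule le_imp_power_dvd) (simp add: q)
      ultimately show ?thesis by (metis dvd_mult2)
    qed
    ultimately show ?thesis
      unfolding fps_cong_def by (metis dvd_add dvd_mult)
  qed
  define C2 where "C2 = B2 - C ^ 2 * B0"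
  \<comment> \<open>The expansion of $w^q$ to three terms depends on $q$ modulo $p$ only.\<close>
  have wq: "fps_cong 3 (w ^ q) (w ^ 2)"
    using fps_cong_mult[OF fps_cong_linear_power_CHAR[OF p, of c r] fps_cong_refl[of 3 "w ^ 2"]]
    by (simp only: q w_def C_def power_add mult_1)
  have "w * (B0 * x ^ q + C2 * x ^ (q + 2)) = fps_X ^ q * (w * (B0 * w ^ q + C2 * fps_X ^ 2 * (w ^ q * w ^ 2)))"
    by (simp add: xw power_mult_distrib power_add power2_eq_square algebra_simps)
  also have "fps_cong (q + 3) \<dots> (fps_X ^ q * (w * (B0 * w ^ 2 + C2 * fps_X ^ 2 * (w ^ 2 * w ^ 2))))"
    by (intro fps_cong_scale fps_cong_mult fps_cong_add fps_cong_refl wq) auto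
  also have "fps_cong (q + 3) \<dots> (fps_X ^ q * (Q * (1 + 2 * C * fps_X)))"
  proof (intro fps_cong_scale)
    have "w * (B0 * w ^ 2 + C2 * fps_X ^ 2 * (w ^ 2 * w ^ 2)) = w ^ 3 * (B0 + C2 * fps_X ^ 2 * w ^ 2)"
      by (simp add: eval_nat_numeral algebra_simps)
    with straightening_identity[of C fps_X B0 B2]
    have "fps_X ^ 3 dvd w * (B0 * w ^ 2 + C2 * fps_X ^ 2 * (w ^ 2 * w ^ 2)) - Q * (1 + 2 * C * fps_X)"
      by (simp only: w_def Q_def C2_def dvd_triv_left)
    thus "fps_cong 3 (w * (B0 * w ^ 2 + C2 * fps_X ^ 2 * (w ^ 2 * w ^ 2))) (Q * (1 + 2 * C * fps_X))"
      by (simp add: fps_cong_def)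
  qed simp
  finally have "fps_cong (q + 3) (w * u) (w * (B0 * x ^ q + C2 * x ^ (q + 2)))"
    using 3 fps_cong_sym fps_cong_trans by blast
  hence "fps_cong (q + 3) u (B0 * x ^ q + C2 * x ^ (q + 2))"
    by (rule fps_cong_cancel_unit) (rule w0)
  moreover have "C2 = fps_const (b2 - c ^ 2 * b0)"
    by (simp add: C2_def B2_def B0_def C_def)
  ultimately show ?thesis
    by (intro that[OF 1 2]) (simp add: B0_def)
qed

text \<open>
  The square of $u$ has order $2q$. It is visible at the precision $q + 3$ only for $q = 2$, and there
  it is the source of the correction $\frac32 b_0^2$.
\<close>

lemma comp_diff_straightening_power:
  fixes g :: "'a::field fps"
  assumes p: "prime p" "odd p" "CHAR('a) = p" and q: "q = p * r + 2"
    and c: "c * b0 = b1"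
    and g: "fps_cong (q + 4) g (fps_X + fps_X ^ (q + 1) * fps_quadratic b0 b1 b2)"
    and x: "x = fps_X * (1 + fps_const c * fps_X)"
  shows "fps_cong (m + q + 3) (comp_diff g (x ^ m))
           (fps_const (of_nat m * b0) * x ^ (m + q)
            + fps_const (of_nat m * (b2 - c ^ 2 * b0)
                + of_nat (m choose 2) * (if q = 2 then b0 ^ 2 else 0)) * x ^ (m + q + 2))"
proof -
  define c2 eps where "c2 = b2 - c ^ 2 * b0" and "eps = (if q = 2 then b0 ^ 2 else 0)"
  obtain u where u: "x oo g = x * (1 + u)" "fps_X ^ q dvd u"
    "fps_cong (q + 3) u (fps_const b0 * x ^ q + fps_const c2 * x ^ (q + 2))"
    unfolding c2_def by (rule straightening_coordinate[OF assms])
  have X: "fps_X dvd x" by (simp add: x)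
  have g0: "g $ 0 = 0"
    using g by (auto simp: fps_cong_def dvd_def algebra_simps)
  have usq: "fps_cong (q + 3) (u ^ 2) (fps_const eps * x ^ (q + 2))"
  proof (cases "q = 2")
    case True
    define z where "z = fps_const b0 * x ^ 2"
    have x2: "fps_X ^ 2 dvd x ^ 2" and x4: "fps_X ^ 4 dvd x ^ 4"
      by (intro dvd_power_same X)+
    have x3: "fps_X ^ 3 dvd x ^ 4"
      by (rule dvd_trans[OF _ x4]) (rule le_imp_power_dvd, simp)
    have "fps_cong 3 u (z + fps_const c2 * x ^ 4)"
      using u(3) fps_cong_mono[of 5 _ _ 3] by (simp add: True z_def)
    also have "fps_cong 3 \<dots> (z + 0)"
      using x3 by (intro fps_cong_add fps_cong_refl) (simp add: fps_cong_0)
    finally have "fps_X ^ 3 dvd u - z" by (simp add: fps_cong_def)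
    moreover have "fps_X ^ 2 dvd u + z"
      using u(2) x2 by (auto simp: True z_def intro!: dvd_add dvd_mult)
    ultimately have "fps_X ^ 3 * fps_X ^ 2 dvd (u - z) * (u + z)"
      by (rule mult_dvd_mono)
    moreover have "(u - z) * (u + z) = u ^ 2 - z ^ 2" by (simp add: algebra_simps power2_eq_square)
    moreover have "z ^ 2 = fps_const eps * x ^ (q + 2)"
      by (simp add: z_def True eps_def power_mult_distrib flip: power_mult)
    ultimately show ?thesis
      by (simp add: fps_cong_def True flip: power_add)
  next
    case False
    have "q \<ge> 3" using False q by (cases "p * r") auto
    have "fps_X ^ (q * 2) dvd u ^ 2"
      using u(2) by (simp add: power_mult dvd_power_same)
    hence "fps_X ^ (q + 3) dvd u ^ 2"
      by (rule dvd_trans[rotated]) (rule le_imp_power_dvd, use \<open>q \<ge> 3\<close> in simp)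
    thus ?thesis by (simp add: False eps_def fps_cong_0)
  qed
  have "fps_cong (m + 3 * q) (comp_diff g (x ^ m)) (x ^ m * (of_nat m * u + of_nat (m choose 2) * u ^ 2))"
    by (rule comp_diff_power[OF g0 u(1) X u(2)])
  hence "fps_cong (m + (q + 3)) (comp_diff g (x ^ m)) (x ^ m * (of_nat m * u + of_nat (m choose 2) * u ^ 2))"
    by (rule fps_cong_mono) (simp add: q)
  also have "fps_cong (m + (q + 3)) \<dots> (x ^ m * (of_nat m * (fps_const b0 * x ^ q + fps_const c2 * x ^ (q + 2))
       + of_nat (m choose 2) * (fps_const eps * x ^ (q + 2))))"
    by (intro fps_cong_scale fps_cong_add fps_cong_mult fps_cong_refl u(3) usq dvd_power_same X)
  also have "\<dots> = fps_const (of_nat m * b0) * x ^ (m + q)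
      + fps_const (of_nat m * c2 + of_nat (m choose 2) * eps) * x ^ (m + q + 2)"
    by (simp add: power_add algebra_simps flip: fps_of_nat fps_const_mult fps_const_add)
  finally show ?thesis by (simp add: c2_def eps_def add.assoc)
qed

section \<open>The p-th iterate when the leading coefficient is nonzero\<close>

text \<open>
  The computation of $T^p (x^{p-2})$ described at the beginning. The value
  $\kappa = e(m)$ for $m \equiv -2$ enters twice, at the first application of $T$ (where the exponent
  is $p - 2$) and at the last one (where the surviving exponent is again $-2$ modulo $p$); this
  coincidence makes the three new coefficients proportional to $b_0$, $b_1$, $b_2'$.
\<close>

lemma iterate_CHAR_step_nonzero:
  fixes g :: "'a::field fps"
  assumes p: "prime p" "odd p" "CHAR('a) = p" and q: "q = p * r + 2"
    and b0: "b0 \<noteq> 0"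
    and g: "fps_cong (q + 4) g (fps_X + fps_X ^ (q + 1) * fps_quadratic b0 b1 b2)"
    and b2': "b2' = b2 - (if q = 2 then 3 / 2 * b0 ^ 2 else 0)"
    and \<mu>: "\<mu> = b0 ^ (p - 3) * (b1 ^ 2 - b0 * b2')"
  shows "fps_cong (p * q + 6) (fps_iterate g p)
           (fps_X + fps_X ^ (p * q + 3) * fps_quadratic (\<mu> * b0) (\<mu> * b1) (\<mu> * b2'))"
proof -
  have p3: "p \<ge> 3" by (rule odd_prime_ge_3[OF p(1,2)])
  have two: "(2::'a) \<noteq> 0" by (rule two_neq_0_CHAR[OF p])
  have p0: "of_nat p = (0::'a)" by (simp flip: p(3))
  have pm2: "of_nat (p - 2) = (-2::'a)" using p3 p0 by (simp add: of_nat_diff)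
  have q2: "of_nat q = (2::'a)" by (simp add: q p0)
  have g0: "g $ 0 = 0"
    using g by (auto simp: fps_cong_def dvd_def algebra_simps)
  have gX: "fps_X ^ Suc q dvd g - fps_X"
  proof -
    have "fps_X ^ Suc q dvd g - (fps_X + fps_X ^ (q + 1) * fps_quadratic b0 b1 b2)"
      using fps_cong_mono[OF g, of "Suc q"] by (simp add: fps_cong_def)
    hence "fps_X ^ Suc q dvd g - (fps_X + fps_X ^ (q + 1) * fps_quadratic b0 b1 b2)
             + fps_X ^ (q + 1) * fps_quadratic b0 b1 b2"
      by (intro dvd_add) simp_all
    thus ?thesis by (simp add: algebra_simps)
  qed
  define c where "c = b1 / b0"
  have c: "c * b0 = b1" by (simp add: c_def b0)
  define w where "w = 1 + fps_const c * fps_X"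
  define x where "x = fps_X * w"
  have w0: "w $ 0 = 1" by (simp add: w_def)
  have Xx: "fps_X dvd x" by (simp add: x_def)
  have Xxm: "fps_X ^ m dvd x ^ m" for m by (intro dvd_power_same Xx)
  define c2 eps where "c2 = b2 - c ^ 2 * b0" and "eps = (if q = 2 then b0 ^ 2 else 0)"
  define e where "e m = of_nat m * c2 + of_nat (m choose 2) * eps" for m
  define \<kappa> where "\<kappa> = -2 * c2 + 3 * eps"
  define T where "T = comp_diff g"
  \<comment> \<open>Over the integers $m (m - 1) / 2$ is $3$ at $m = -2$.\<close>
  have e\<kappa>: "e m = \<kappa>" if m: "of_nat m = (-2::'a)" for m
  proof -
    have "m \<noteq> 0" using m two by (cases m) auto
    have "even (m * (m - 1))" by (cases "even m") auto
    hence "2 * (m choose 2) = m * (m - 1)" by (simp add: choose_two)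
    hence "(2::'a) * of_nat (m choose 2) = of_nat m * of_nat (m - 1)"
      by (metis of_nat_mult of_nat_numeral)
    also have "of_nat (m - 1) = (of_nat m - 1 :: 'a)" using \<open>m \<noteq> 0\<close> by (simp add: of_nat_diff)
    finally have "(2::'a) * of_nat (m choose 2) = 2 * 3" by (simp add: m)
    hence "(of_nat (m choose 2)::'a) = 3" using two by (metis mult_left_cancel)
    thus ?thesis by (simp add: e_def \<kappa>_def m)
  qed
  have Tm: "fps_cong (m + q + 3) (comp_diff g (x ^ m))
              (fps_const (of_nat m * b0) * x ^ (m + q) + fps_const (e m) * x ^ (m + q + 2))" for m
    unfolding e_def c2_def eps_def
    by (rule comp_diff_straightening_power[OF p q c g]) (simp add: x_def w_def)
  note leading = funpow_comp_diff_leading[OF g0 gX Xx Tm, folded T_def]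
  have T_add: "(T ^^ j) (h + k) = (T ^^ j) h + (T ^^ j) k" for j h k
    by (simp add: T_def funpow_comp_diff_add)
  have T_const: "(T ^^ j) (fps_const s * h) = fps_const s * (T ^^ j) h" for j s h
    by (simp add: T_def funpow_comp_diff_const_mult g0)
  have vanish: "fps_X ^ (m + j * q + 2) dvd (T ^^ j) (x ^ m)"
    if "l < j" "of_nat m + 2 * of_nat l = (0::'a)" for m j l
  proof -
    obtain C where C: "fps_cong (m + j * q + 3) ((T ^^ j) (x ^ m))
           (fps_const (b0 ^ j * (\<Prod>l<j. of_nat (m + l * q))) * x ^ (m + j * q)
            + fps_const C * x ^ (m + j * q + 2))"
      using leading by blast
    have "(\<Prod>l<j. of_nat (m + l * q) :: 'a) = 0"
      using that by (auto simp: q2 intro!: bexI[of _ l] simp: mult.commute)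
    hence "fps_cong (m + j * q + 3) ((T ^^ j) (x ^ m)) (fps_const C * x ^ (m + j * q + 2))"
      using C by (simp only: mult_zero_right fps_const_0_eq_0 mult_zero_left add_0)
    hence "fps_cong (m + j * q + 2) ((T ^^ j) (x ^ m)) (fps_const C * x ^ (m + j * q + 2))"
      by (rule fps_cong_mono) simp
    moreover have "fps_cong (m + j * q + 2) (fps_const C * x ^ (m + j * q + 2)) 0"
      unfolding fps_cong_0 by (intro dvd_mult Xxm)
    ultimately show ?thesis using fps_cong_trans fps_cong_0 by blast
  qed

  \<comment> \<open>$P = p - 2 + q$ is the leading exponent of $T x^{p-2}$, and $M$ that of the image of $x^{P+2}$
    under $T^{p-1}$.\<close>
  define P where "P = p * (r + 1)"
  define J where "J = p - 1"
  define M where "M = P + 2 + J * q"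
  have J: "J = Suc (p - 2)" using p3 by (simp add: J_def)
  have M: "M = p * q + p"
  proof -
    obtain t where "p = t + 1" using p3 by (metis add.commute le_add_diff_inverse2 le_trans one_le_numeral)
    thus ?thesis by (simp add: M_def J_def P_def q algebra_simps)
  qed
  have P0: "of_nat P = (0::'a)" by (simp add: P_def p0)

  \<comment> \<open>The product without its last factor $2(p-1) \equiv -2$ is $h = 1/2$; the last application of $T$ is
    kept apart because there the second coefficient is needed as well.\<close>
  define h where "h = (\<Prod>l<p-2. 2 + 2 * of_nat l :: 'a)"
  have h: "h * 2 = 1"
  proof -
    have "(\<Prod>l<Suc (p - 2). 2 + 2 * of_nat l :: 'a) = -1"
      using prod_even_CHAR[OF p] J by (simp add: J_def)
    thus ?thesis by (simp add: h_def pm2 algebra_simps)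
  qed
  define A where "A = b0 ^ (p - 2) * h"

  have main: "fps_cong (M + 3) ((T ^^ J) (x ^ (P + 2)))
                (fps_const (A * (-2 * b0)) * x ^ M + fps_const (A * \<kappa>) * x ^ (M + 2))"
  proof -
    define m where "m = P + 2 + (p - 2) * q"
    have m: "of_nat m = (-2::'a)" by (simp add: m_def P0 pm2 q2)
    have mM: "m + q = M" by (simp add: m_def M_def J)
    have "(\<Prod>l<p-2. of_nat (P + 2 + l * q) :: 'a) = h"
      unfolding h_def by (intro prod.cong refl) (simp add: P0 q2 mult.commute)
    then obtain C where C: "fps_cong (m + 3) ((T ^^ (p - 2)) (x ^ (P + 2)))
        (fps_const A * x ^ m + fps_const C * x ^ (m + 2))"
      using leading[where m = "P + 2" and j = "p - 2"] by (auto simp: m_def A_def)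
    have "fps_cong (m + 3 + q) ((T ^^ J) (x ^ (P + 2)))
        (fps_const A * T (x ^ m) + fps_const C * T (x ^ (m + 2)))"
      using comp_diff_cong[OF gX C, folded T_def] T_add[of 1] T_const[of 1] by (simp add: J)
    hence "fps_cong (M + 3) ((T ^^ J) (x ^ (P + 2)))
        (fps_const A * T (x ^ m) + fps_const C * T (x ^ (m + 2)))"
      by (simp add: add_ac flip: mM)
    also have "fps_cong (M + 3) \<dots>
        (fps_const A * (fps_const (-2 * b0) * x ^ M + fps_const \<kappa> * x ^ (M + 2)) + fps_const C * 0)"
    proof (intro fps_cong_add fps_cong_mult fps_cong_refl)
      show "fps_cong (M + 3) (T (x ^ m)) (fps_const (-2 * b0) * x ^ M + fps_const \<kappa> * x ^ (M + 2))"
        using Tm[of m] by (simp only: m e\<kappa>[OF m] T_def mM)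
      \<comment> \<open>The exponent $m + 2$ is a multiple of $p$, so that the unknown $C$ does not matter.\<close>
      have "fps_X ^ (m + 2 + 1 * q + 2) dvd (T ^^ 1) (x ^ (m + 2))"
        by (rule vanish[where l = 0]) (simp_all add: m)
      moreover have "(T ^^ 1) (x ^ (m + 2)) = T (x ^ (m + 2))" by simp
      moreover have "M + 3 \<le> m + 2 + 1 * q + 2" by (simp flip: mM)
      ultimately have "fps_X ^ (M + 3) dvd T (x ^ (m + 2))"
        by (metis le_imp_power_dvd dvd_trans)
      thus "fps_cong (M + 3) (T (x ^ (m + 2))) 0"
        by (simp add: fps_cong_0)
    qed
    finally show ?thesis
      by (simp only: distrib_left mult_zero_right add_0_left add_0_right fps_const_mult
          flip: mult.assoc)
  qed

  have Tp: "fps_cong (M + 3) ((T ^^ p) (x ^ (p - 2)))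
      (fps_const (\<kappa> * A) * (fps_const (-2 * b0) * x ^ M + fps_const \<kappa> * x ^ (M + 2)))"
  proof -
    have P: "p - 2 + q = P" using p3 by (simp add: P_def q)
    define L where "L = fps_const (-2 * b0) * x ^ P + fps_const \<kappa> * x ^ (P + 2)"
    have L: "fps_X ^ (P + 3) dvd T (x ^ (p - 2)) - L"
      using Tm[of "p - 2"] by (simp only: pm2 e\<kappa>[OF pm2] P L_def T_def fps_cong_def)
    \<comment> \<open>Two more terms have to be split off, since the result is wanted to relative degree $2$ and starts
      at the image of $x^{P+2}$.\<close>
    obtain k3 where k3: "fps_X ^ Suc (P + 3) dvd T (x ^ (p - 2)) - L - fps_const k3 * x ^ (P + 3)"
      by (rule fps_expand_next[OF x_def w0 L])
    obtain k4 where k4: "fps_X ^ Suc (Suc (P + 3)) dvd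
        T (x ^ (p - 2)) - L - fps_const k3 * x ^ (P + 3) - fps_const k4 * x ^ (Suc (P + 3))"
      by (rule fps_expand_next[OF x_def w0 k3])
    have "fps_cong (P + 5) (T (x ^ (p - 2))) (L + fps_const k3 * x ^ (P + 3) + fps_const k4 * x ^ (P + 4))"
      using k4 by (simp add: fps_cong_def algebra_simps numeral_eq_Suc)
    from funpow_comp_diff_cong[OF gX this, of J, folded T_def]
    have "fps_cong (P + 5 + J * q) ((T ^^ J) (T (x ^ (p - 2))))
       ((T ^^ J) (L + fps_const k3 * x ^ (P + 3) + fps_const k4 * x ^ (P + 4)))" .
    moreover have "(T ^^ J) (T (x ^ (p - 2))) = (T ^^ p) (x ^ (p - 2))"
    proof -
      have "p = Suc J" using p3 by (simp add: J_def)
      thus ?thesis by (simp only: funpow_Suc_right o_apply)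
    qed
    moreover have "P + 5 + J * q = M + 3" by (simp add: M_def)
    ultimately have "fps_cong (M + 3) ((T ^^ p) (x ^ (p - 2)))
       (fps_const (-2 * b0) * (T ^^ J) (x ^ P) + fps_const \<kappa> * (T ^^ J) (x ^ (P + 2))
        + fps_const k3 * (T ^^ J) (x ^ (P + 3)) + fps_const k4 * (T ^^ J) (x ^ (P + 4)))"
      by (simp only: L_def T_add T_const)
    also have "fps_cong (M + 3) \<dots> (fps_const (-2 * b0) * 0
        + fps_const \<kappa> * (fps_const (A * (-2 * b0)) * x ^ M + fps_const (A * \<kappa>) * x ^ (M + 2))
        + fps_const k3 * 0 + fps_const k4 * 0)"
    proof (intro fps_cong_add fps_cong_mult fps_cong_refl main)
      \<comment> \<open>$x^P$ is the $p$-th power of $x^{r+1}$.\<close>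
      have "fps_X ^ ((r + 1) + J * q) dvd (T ^^ J) (x ^ (r + 1))"
        unfolding T_def by (rule funpow_comp_diff_order[OF gX Xxm])
      hence "(fps_X ^ ((r + 1) + J * q)) ^ p dvd ((T ^^ J) (x ^ (r + 1))) ^ p"
        by (rule dvd_power_same)
      also have "((T ^^ J) (x ^ (r + 1))) ^ p = (T ^^ J) (x ^ P)"
        unfolding T_def comp_diff_frobenius[OF g0 p(1,3), symmetric]
        by (simp only: P_def mult.commute[of p "r + 1"] power_mult)
      finally have *: "fps_X ^ (((r + 1) + J * q) * p) dvd (T ^^ J) (x ^ P)"
        by (simp only: power_mult)
      have "M + 3 \<le> ((r + 1) + J * q) * p"
      proof -
        have "5 \<le> 2 * (2 * (2::nat))" by simp
        also have "\<dots> \<le> (p - 1) * (J * q)"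
          using p3 by (intro mult_le_mono) (auto simp: J_def q)
        finally have "P + J * q + 5 \<le> P + (J * q + (p - 1) * (J * q))" by simp
        also have "\<dots> = ((r + 1) + J * q) * p"
          using p3 by (cases p) (auto simp: P_def algebra_simps)
        finally show ?thesis by (simp add: M_def)
      qed
      thus "fps_cong (M + 3) ((T ^^ J) (x ^ P)) 0"
        unfolding fps_cong_0 using * le_imp_power_dvd dvd_trans by blast
      have "fps_X ^ (P + 3 + J * q + 2) dvd (T ^^ J) (x ^ (P + 3))"
      \<comment> \<open>The exponents are congruent to $3, 5, 7, \dots$, and $3 + 2l = p$ for this $l$.\<close>
      proof (rule vanish[where l = "(p - 3) div 2"])
        show "(p - 3) div 2 < J" using p3 by (simp add: J_def)
        have "2 * ((p - 3) div 2) = p - 3" using p(2) p3 by simp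
        hence "2 * of_nat ((p - 3) div 2) = (of_nat (p - 3) :: 'a)"
          by (metis of_nat_mult of_nat_numeral)
        also have "of_nat (p - 3) = (-3::'a)" using p3 p0 by (simp add: of_nat_diff)
        finally show "of_nat (P + 3) + 2 * of_nat ((p - 3) div 2) = (0::'a)" by (simp add: P0)
      qed
      moreover have "P + 3 + J * q + 2 = M + 3" by (simp add: M_def)
      ultimately show "fps_cong (M + 3) ((T ^^ J) (x ^ (P + 3))) 0"
        by (simp only: fps_cong_0)
      have "fps_X ^ (P + 4 + J * q + 2) dvd (T ^^ J) (x ^ (P + 4))"
        \<comment> \<open>The exponents are congruent to $4, 6, \dots, 2p$.\<close>
        by (rule vanish[where l = "p - 2"]) (use p3 in \<open>simp_all add: J_def P0 pm2\<close>)
      moreover have "M + 3 \<le> P + 4 + J * q + 2" by (simp add: M_def)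
      ultimately show "fps_cong (M + 3) ((T ^^ J) (x ^ (P + 4))) 0"
        unfolding fps_cong_0 using le_imp_power_dvd dvd_trans by blast
    qed
    finally show ?thesis by (simp only: distrib_left mult_zero_right add_0_left add_0_right fps_const_mult
          flip: mult.assoc)
  qed

  define G where "G = fps_iterate g p"
  have G0: "G $ 0 = 0" by (simp add: G_def fps_iterate_nth_0 g0)
  have comp_G: "comp_diff G k = (T ^^ p) k" for k
    using compose_fps_iterate_CHAR[OF g0 p(1,3), of k] by (simp add: comp_diff_def G_def T_def)
  have pq: "p * q \<ge> 6" using mult_le_mono[OF p3, of 2 q] by (simp add: q)
  define \<eta> where "\<eta> = comp_diff G x"
  define N where "N = p * q + 3"
  have "fps_X ^ (1 + p * q) dvd \<eta>"
    unfolding \<eta>_def comp_G T_def by (rule funpow_comp_diff_order[OF gX]) (simp add: Xx)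
  then obtain y0 where y0: "\<eta> = fps_X ^ (1 + p * q) * y0" by (auto simp: dvd_def)
  define y where "y = fps_X ^ (p * q) * (y0 * inverse w)"
  have "w * inverse w = 1" using w0 by (simp add: inverse_mult_eq_1')
  hence \<eta>y: "\<eta> = x * y" by (simp add: y_def x_def y0 algebra_simps)
  have yX: "fps_X ^ (p * q) dvd y" by (simp add: y_def)
  \<comment> \<open>From $x^{p-2} \circ g^p$ to $x \circ g^p = x (1 + y)$: to first order $(1 + y)^{p-2} - 1$ is
    $-2y$, and the square of $y$ is beyond the precision.\<close>
  have \<eta>_2: "fps_cong (N + 3) (fps_const (-2) * \<eta>)
          (fps_const (\<kappa> * A) * (fps_const (-2 * b0) * x ^ N + fps_const \<kappa> * x ^ (N + 2)))"
  proof -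
    have "x oo G = x * (1 + y)"
      using \<eta>y by (simp add: \<eta>_def comp_diff_def algebra_simps)
    from comp_diff_power[OF G0 this Xx yX, of "p - 2"]
    have "fps_cong (p - 2 + 3 * (p * q)) ((T ^^ p) (x ^ (p - 2)))
      (x ^ (p - 2) * (fps_const (-2) * y + of_nat ((p - 2) choose 2) * y ^ 2))"
      by (simp add: comp_G pm2 flip: fps_of_nat)
    hence "fps_cong (M + 3) ((T ^^ p) (x ^ (p - 2)))
      (x ^ (p - 2) * (fps_const (-2) * y + of_nat ((p - 2) choose 2) * y ^ 2))"
      by (rule fps_cong_mono) (use p3 pq in \<open>simp add: M\<close>)
    also have "fps_cong (M + 3) \<dots> (x ^ (p - 2) * (fps_const (-2) * y + 0))"
    proof -
      have "fps_X ^ (p * q * 2) dvd y ^ 2"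
        using yX by (simp only: power_mult dvd_power_same)
      hence "fps_cong (p - 2 + p * q * 2) (x ^ (p - 2) * (fps_const (-2) * y + of_nat ((p - 2) choose 2) * y ^ 2))
          (x ^ (p - 2) * (fps_const (-2) * y + 0))"
        by (intro fps_cong_scale fps_cong_add fps_cong_refl Xxm) (simp add: fps_cong_0)
      thus ?thesis by (rule fps_cong_mono) (use p3 pq in \<open>simp add: M\<close>)
    qed
    also have "x ^ (p - 2) * (fps_const (-2) * y + 0) = x ^ (p - 3) * (fps_const (-2) * \<eta>)"
    proof -
      have "p - 2 = Suc (p - 3)" using p3 by simp
      thus ?thesis by (simp add: \<eta>y algebra_simps)
    qed
    finally have M_cong: "fps_cong (M + 3) (x ^ (p - 3) * (fps_const (-2) * \<eta>))
       (fps_const (\<kappa> * A) * (fps_const (-2 * b0) * x ^ M + fps_const \<kappa> * x ^ (M + 2)))"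
      using Tp fps_cong_sym fps_cong_trans by blast
    have x_split: "x ^ (p - 3) * k = fps_X ^ (p - 3) * (w ^ (p - 3) * k)" for k
      by (simp add: x_def power_mult_distrib mult_ac)
    have factor: "k1 * (k2 * x ^ (p - 3 + N) + k3 * x ^ (p - 3 + N + 2))
        = x ^ (p - 3) * (k1 * (k2 * x ^ N + k3 * x ^ (N + 2)))" for k1 k2 k3
      by (simp add: power_add algebra_simps)
    have "M = p - 3 + N" using p3 by (simp add: M N_def)
    from M_cong[unfolded this factor, unfolded x_split add.assoc]
    have "fps_cong (p - 3 + (N + 3)) (fps_X ^ (p - 3) * (w ^ (p - 3) * (fps_const (-2) * \<eta>)))
       (fps_X ^ (p - 3) * (w ^ (p - 3) * (fps_const (\<kappa> * A) * (fps_const (-2 * b0) * x ^ N + fps_const \<kappa> * x ^ (N + 2)))))" .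
    hence "fps_cong (N + 3) (w ^ (p - 3) * (fps_const (-2) * \<eta>))
       (w ^ (p - 3) * (fps_const (\<kappa> * A) * (fps_const (-2 * b0) * x ^ N + fps_const \<kappa> * x ^ (N + 2))))"
      by (rule fps_cong_cancel_X)
    thus ?thesis by (rule fps_cong_cancel_unit) (simp add: w0 fps_power_zeroth)
  qed
  \<comment> \<open>The coefficient $b_2'$ in the straightened coordinate.\<close>
  define c' where "c' = c2 - 3 / 2 * eps"
  have \<kappa>: "\<kappa> = -2 * c'" using two by (simp add: \<kappa>_def c'_def field_simps)
  have c': "b2' = c' + c ^ 2 * b0"
    by (simp add: c'_def c2_def b2' eps_def)
  have \<mu>': "\<mu> = - c' * b0 ^ (p - 2)"
  proof -
    have "p - 2 = Suc (p - 3)" using p3 by simp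
    thus ?thesis by (simp add: \<mu> c' power2_eq_square algebra_simps flip: c)
  qed
  define B0 C C' where "B0 = fps_const b0" and "C = fps_const c" and "C' = fps_const c'"
  have "fps_cong (N + 3) \<eta> (fps_const \<mu> * (B0 * x ^ N + C' * x ^ (N + 2)))"
  proof -
    have "fps_cong (N + 3) (fps_const (-h) * (fps_const (-2) * \<eta>))
       (fps_const (-h) * (fps_const (\<kappa> * A) * (fps_const (-2 * b0) * x ^ N + fps_const \<kappa> * x ^ (N + 2))))"
      by (rule fps_cong_mult[OF fps_cong_refl \<eta>_2])
    moreover have "fps_const (-h) * (fps_const (-2) * \<eta>) = \<eta>"
    proof -
      have "fps_const (-h) * fps_const (-2) = (1 :: 'a fps)" using h by simp
      thus ?thesis by (metis mult.assoc mult_1)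
    qed
    moreover have "fps_const (-h) * (fps_const (\<kappa> * A) * (fps_const (-2 * b0) * x ^ N + fps_const \<kappa> * x ^ (N + 2)))
        = fps_const (-h * \<kappa> * A * -2) * (B0 * x ^ N + C' * x ^ (N + 2))"
    proof -
      have "k1 * (k2 * (k3 * B0 * x ^ N + k3 * C' * x ^ (N + 2)))
          = k1 * k2 * k3 * (B0 * x ^ N + C' * x ^ (N + 2))" for k1 k2 k3
        by (simp add: algebra_simps)
      moreover have "fps_const (-2 * b0) = fps_const (-2) * B0" "fps_const \<kappa> = fps_const (-2) * C'"
        by (simp_all add: B0_def C'_def \<kappa>)
      moreover have "fps_const (-h * \<kappa> * A * -2) = fps_const (-h) * fps_const (\<kappa> * A) * fps_const (-2)"
        by (simp add: mult_ac)
      ultimately show ?thesis by (simp only:)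
    qed
    moreover have "-h * \<kappa> * A * -2 = \<mu>"
    proof -
      have "-h * \<kappa> * A * -2 = - (h * 2) * (h * 2) * c' * b0 ^ (p - 2)"
        by (simp add: \<kappa> A_def)
      thus ?thesis by (simp add: h \<mu>')
    qed
    ultimately show ?thesis by simp
  qed
  also have "\<dots> = fps_X ^ N * (fps_const \<mu> * (w ^ N * (B0 + C' * fps_X ^ 2 * w ^ 2)))"
    by (simp add: x_def power_add power_mult_distrib power2_eq_square algebra_simps)
  also have "fps_cong (N + 3) \<dots> (fps_X ^ N * (fps_const \<mu> * (w ^ 3 * (B0 + C' * fps_X ^ 2 * w ^ 2))))"
  proof -
    have "fps_cong 3 (w ^ N) (w ^ 3)"
      using fps_cong_mult[OF fps_cong_linear_power_CHAR[OF p, of c q] fps_cong_refl[of 3 "w ^ 3"]]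
      by (simp only: N_def w_def power_add mult_1)
    thus ?thesis by (intro fps_cong_scale fps_cong_mult fps_cong_refl) simp_all
  qed
  also have "fps_cong (N + 3) \<dots> (fps_X ^ N * (fps_const \<mu> *
      ((B0 + C * B0 * fps_X + (C' + C ^ 2 * B0) * fps_X ^ 2) * (1 + 2 * C * fps_X))))"
  proof (rule fps_cong_scale[OF fps_cong_mult[OF fps_cong_refl]])
    have "fps_X ^ 3 dvd w ^ 3 * (B0 + C' * fps_X ^ 2 * w ^ 2)
          - (B0 + C * B0 * fps_X + (C' + C ^ 2 * B0) * fps_X ^ 2) * (1 + 2 * C * fps_X)"
      using straightening_identity[of C fps_X B0 "C' + C ^ 2 * B0"]
      by (simp only: w_def C_def[symmetric] add_diff_cancel_right' dvd_triv_left)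
    thus "fps_cong 3 (w ^ 3 * (B0 + C' * fps_X ^ 2 * w ^ 2))
            ((B0 + C * B0 * fps_X + (C' + C ^ 2 * B0) * fps_X ^ 2) * (1 + 2 * C * fps_X))"
      by (simp add: fps_cong_def)
  qed simp
  also have "B0 + C * B0 * fps_X + (C' + C ^ 2 * B0) * fps_X ^ 2 = fps_quadratic b0 b1 b2'"
    by (simp add: fps_quadratic_def B0_def C_def C'_def c' flip: c)
  finally have \<eta>_cong: "fps_cong (N + 3) \<eta>
     ((1 + 2 * C * fps_X) * (fps_X ^ N * (fps_const \<mu> * fps_quadratic b0 b1 b2')))"
    by (simp add: mult_ac)
  \<comment> \<open>Back from $x$ to $\zeta$: the increments $\eta$ of $x$ and $\delta$ of $\zeta$ differ by the
    factor $1 + 2c\zeta$, the derivative of $x$, up to the square of $\delta$.\<close>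
  define \<delta> where "\<delta> = G - fps_X"
  have \<eta>\<delta>: "\<eta> = (1 + 2 * C * fps_X) * \<delta> + C * \<delta> ^ 2"
  proof -
    have "x oo G = G * (1 + C * G)"
      using G0 by (simp add: x_def w_def C_def fps_compose_mult_distrib fps_compose_add_distrib)
    thus ?thesis
      by (simp add: \<eta>_def comp_diff_def \<delta>_def x_def w_def C_def algebra_simps power2_eq_square)
  qed
  have "fps_X ^ (1 + p * q) dvd (T ^^ p) fps_X"
    unfolding T_def by (rule funpow_comp_diff_order[OF gX]) simp
  moreover have "(T ^^ p) fps_X = \<delta>"
    using G0 by (simp add: comp_diff_def \<delta>_def flip: comp_G)
  ultimately have "fps_X ^ ((1 + p * q) * 2) dvd \<delta> ^ 2"
    by (simp only: power_mult dvd_power_same)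
  hence "fps_X ^ (N + 3) dvd \<delta> ^ 2"
    by (rule dvd_trans[rotated]) (rule le_imp_power_dvd, use pq in \<open>simp add: N_def\<close>)
  hence "fps_cong (N + 3) \<eta> ((1 + 2 * C * fps_X) * \<delta>)"
    by (simp add: \<eta>\<delta> fps_cong_def)
  hence "fps_cong (N + 3) ((1 + 2 * C * fps_X) * \<delta>)
     ((1 + 2 * C * fps_X) * (fps_X ^ N * (fps_const \<mu> * fps_quadratic b0 b1 b2')))"
    using \<eta>_cong fps_cong_sym fps_cong_trans by blast
  hence "fps_cong (N + 3) \<delta> (fps_X ^ N * (fps_const \<mu> * fps_quadratic b0 b1 b2'))"
    by (rule fps_cong_cancel_unit) simp
  from fps_cong_add[OF fps_cong_refl[of _ fps_X] this] show ?thesis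
    by (simp add: \<delta>_def G_def N_def fps_quadratic_def algebra_simps flip: fps_const_mult)
qed

section \<open>The p-th iterate in general\<close>

text \<open>
  Now $g - \zeta$ has order at least $q + 2$, so that $T$ gains $Q = q + 1$. For $p \geq 5$ the order
  $1 + pQ$ of $T^p \zeta$ exceeds the precision. For $p = 3$ it does not, but $Q$ is then a multiple
  of $3$, and the exponents $1$, $1 + Q$, $1 + 2Q$ of the leading terms are all $1$ modulo $3$: no
  leading factor vanishes, and the answer is $b_1^3$, as opposed to $0$ for $p \geq 5$. The factor
  $0^{p-3}$ covers both cases.
\<close>

lemma iterate_CHAR_step_zero:
  fixes g :: "'a::field fps"
  assumes p: "prime p" "odd p" "CHAR('a) = p" and q: "q = p * r + 2"
    and g: "fps_cong (q + 4) g (fps_X + fps_X ^ (q + 1) * fps_quadratic 0 b1 b2)"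
  shows "fps_cong (p * q + 6) (fps_iterate g p)
           (fps_X + fps_X ^ (p * q + 3) * (fps_const (0 ^ (p - 3) * b1 ^ 2) * fps_quadratic 0 b1 b2))"
proof -
  have p3: "p \<ge> 3" by (rule odd_prime_ge_3[OF p(1,2)])
  define Q where "Q = q + 1"
  define L where "L = fps_const b1 + fps_const b2 * fps_X"
  obtain R where R: "g - (fps_X + fps_X ^ (q + 1) * fps_quadratic 0 b1 b2) = fps_X ^ (q + 4) * R"
    using g by (auto simp: fps_cong_def dvd_def)
  define v where "v = fps_X ^ Q * (L + fps_X ^ 2 * R)"
  have "g = fps_X + fps_X ^ (q + 1) * fps_quadratic 0 b1 b2 + fps_X ^ (q + 4) * R"
    using R by (simp add: algebra_simps)
  also have "\<dots> = fps_X * (1 + v)"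
    by (simp add: v_def L_def fps_quadratic_def Q_def power2_eq_square algebra_simps numeral_eq_Suc)
  finally have gv: "g = fps_X * (1 + v)" .
  have g0: "g $ 0 = 0" by (simp add: gv)
  have gX: "fps_X ^ Suc Q dvd g - fps_X"
    by (simp add: gv v_def algebra_simps)
  define T where "T = comp_diff g"
  have G: "fps_iterate g p = fps_X + (T ^^ p) fps_X"
    using compose_fps_iterate_CHAR[OF g0 p(1,3), of fps_X] fps_iterate_nth_0[OF g0, of p]
    by (simp add: T_def)
  show ?thesis
  proof (cases "p = 3")
    case False
    hence p5: "p \<ge> 5" using p(2) p3 by (cases "p = 4") auto
    have "fps_X ^ (1 + p * Q) dvd (T ^^ p) fps_X"
      unfolding T_def by (rule funpow_comp_diff_order[OF gX]) simp
    moreover have "p * q + 6 \<le> 1 + p * Q" using p5 by (simp add: Q_def)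
    ultimately have "fps_X ^ (p * q + 6) dvd (T ^^ p) fps_X"
      using le_imp_power_dvd dvd_trans by blast
    thus ?thesis using p5 by (simp add: G fps_cong_def power_0_left)
  next
    case True
    have Q3: "Q = p * (r + 1)" by (simp add: Q_def q True)
    have p0: "of_nat p = (0::'a)" by (simp flip: p(3))
    have three: "(3::'a) = 0" using p0 by (simp add: True)
    have Q0: "of_nat Q = (0::'a)" by (simp add: Q3 p0)
    have Q_ge: "Q \<ge> 3" by (simp add: Q3 True)
    have Tm: "fps_cong (m + Q + 2) (T (fps_X ^ m)) (fps_const (of_nat m) * (fps_X ^ (m + Q) * L))" for m
    proof -
      have vX: "fps_X ^ Q dvd v" by (simp add: v_def)
      have "fps_cong (m + 3 * Q) (T (fps_X ^ m)) (fps_X ^ m * (of_nat m * v + of_nat (m choose 2) * v ^ 2))"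
        unfolding T_def by (rule comp_diff_power[OF g0 _ _ vX]) (simp_all add: g0 flip: gv)
      hence "fps_cong (m + (Q + 2)) (T (fps_X ^ m)) (fps_X ^ m * (of_nat m * v + of_nat (m choose 2) * v ^ 2))"
        by (rule fps_cong_mono) (use Q_ge in simp)
      also have "fps_cong (m + (Q + 2)) \<dots> (fps_X ^ m * (of_nat m * (fps_X ^ Q * L) + of_nat (m choose 2) * 0))"
      proof (rule fps_cong_scale, intro fps_cong_add fps_cong_mult fps_cong_refl)
        show "fps_cong (Q + 2) v (fps_X ^ Q * L)"
          by (simp add: fps_cong_def v_def power_add power2_eq_square algebra_simps)
        have "fps_X ^ (Q * 2) dvd v ^ 2"
          using vX by (simp only: power_mult dvd_power_same)
        moreover have "Q + 2 \<le> Q * 2" using Q_ge by simp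
        ultimately show "fps_cong (Q + 2) (v ^ 2) 0"
          unfolding fps_cong_0 using le_imp_power_dvd dvd_trans by blast
      qed simp
      also have "\<dots> = fps_const (of_nat m) * (fps_X ^ (m + Q) * L)"
        by (simp add: power_add algebra_simps fps_of_nat)
      finally show ?thesis by (simp add: add.assoc)
    qed
    have T_lin: "T (fps_const s * h + fps_const t * k) = fps_const s * T h + fps_const t * T k" for s t h k
      by (simp add: T_def comp_diff_add comp_diff_const_mult[OF g0])
    have L: "fps_X ^ N * L = fps_const b1 * fps_X ^ N + fps_const b2 * fps_X ^ (N + 1)" for N
      by (simp add: L_def algebra_simps)
    have 1: "fps_cong (Q + 3) (T fps_X) (fps_const b1 * fps_X ^ (1 + Q) + fps_const b2 * fps_X ^ (2 + Q))"
      using Tm[of 1] L[of "1 + Q"] by (simp add: numeral_eq_Suc)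
    have "fps_cong (2 * Q + 3) (T (T fps_X))
        (fps_const b1 * T (fps_X ^ (1 + Q)) + fps_const b2 * T (fps_X ^ (2 + Q)))"
      using comp_diff_cong[OF gX 1, folded T_def] by (simp only: T_lin) (simp add: algebra_simps)
    also have "fps_cong (2 * Q + 3) \<dots>
      (fps_const b1 * (fps_const 1 * (fps_X ^ (1 + 2 * Q) * L)) + fps_const b2 * (fps_const 2 * (fps_X ^ (2 + 2 * Q) * fps_const b1)))"
    proof (intro fps_cong_add fps_cong_mult fps_cong_refl)
      show "fps_cong (2 * Q + 3) (T (fps_X ^ (1 + Q))) (fps_const 1 * (fps_X ^ (1 + 2 * Q) * L))"
        using Tm[of "1 + Q"] by (simp add: Q0 algebra_simps numeral_eq_Suc)
      have "fps_cong (2 * Q + 4) (T (fps_X ^ (2 + Q))) (fps_const 2 * (fps_X ^ (2 + 2 * Q) * L))"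
        using Tm[of "2 + Q"] by (simp add: Q0 algebra_simps numeral_eq_Suc)
      hence "fps_cong (2 * Q + 3) (T (fps_X ^ (2 + Q))) (fps_const 2 * (fps_X ^ (2 + 2 * Q) * L))"
        by (rule fps_cong_mono) simp
      also have "fps_cong (2 * Q + 3) \<dots> (fps_const 2 * (fps_X ^ (2 + 2 * Q) * fps_const b1))"
      proof -
        have "fps_cong (2 + 2 * Q + 1) (fps_X ^ (2 + 2 * Q) * L) (fps_X ^ (2 + 2 * Q) * fps_const b1)"
          by (intro fps_cong_scale dvd_refl) (simp add: fps_cong_def L_def)
        moreover have "2 + 2 * Q + 1 = 2 * Q + 3" by simp
        ultimately have "fps_cong (2 * Q + 3) (fps_X ^ (2 + 2 * Q) * L) (fps_X ^ (2 + 2 * Q) * fps_const b1)"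
          by (simp only:)
        thus ?thesis by (rule fps_cong_mult[OF fps_cong_refl])
      qed
      finally show "fps_cong (2 * Q + 3) (T (fps_X ^ (2 + Q))) (fps_const 2 * (fps_X ^ (2 + 2 * Q) * fps_const b1))" .
    qed
    also have "\<dots> = fps_const (b1 ^ 2) * fps_X ^ (1 + 2 * Q) + fps_const (3 * (b1 * b2)) * fps_X ^ (2 + 2 * Q)"
    proof -
      define Y Z :: "'a fps" where "Y = fps_X ^ (1 + 2 * Q)" and "Z = fps_X ^ (2 + 2 * Q)"
      have "Y * L = fps_const b1 * Y + fps_const b2 * Z"
        using L[of "1 + 2 * Q"] by (simp add: Y_def Z_def)
      moreover have "fps_const (3 * (b1 * b2)) = fps_const b1 * fps_const b2 + fps_const b2 * (fps_const 2 * fps_const b1)"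
        by (simp add: mult_ac)
      moreover have "fps_const (b1 ^ 2) = fps_const b1 * fps_const b1"
        by (simp add: power2_eq_square)
      moreover have "k1 * (fps_const 1 * (k1 * Y + k2 * Z)) + k2 * (t * (Z * k1))
          = k1 * k1 * Y + (k1 * k2 + k2 * (t * k1)) * Z" for k1 k2 t
        by (simp add: algebra_simps)
      ultimately show ?thesis
        unfolding Y_def[symmetric] Z_def[symmetric] by (simp only:)
    qed
    \<comment> \<open>The second coefficient is a multiple of $3 = 0$; it is kept as a trivial summand only so that
      $T$ can be distributed as before.\<close>
    finally have 2: "fps_cong (2 * Q + 3) (T (T fps_X)) (fps_const (b1 ^ 2) * fps_X ^ (1 + 2 * Q) + fps_const 0 * 0)"
      by (simp only: three mult_zero_left mult_zero_right fps_const_0_eq_0)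
    have "fps_cong (3 * Q + 3) (T (T (T fps_X))) (fps_const (b1 ^ 2) * T (fps_X ^ (1 + 2 * Q)))"
      using comp_diff_cong[OF gX 2, folded T_def] by (simp only: T_lin) (simp add: algebra_simps)
    also have "fps_cong (3 * Q + 3) \<dots> (fps_const (b1 ^ 2) * (fps_X ^ (1 + 3 * Q) * L))"
    proof (intro fps_cong_mult fps_cong_refl)
      show "fps_cong (3 * Q + 3) (T (fps_X ^ (1 + 2 * Q))) (fps_X ^ (1 + 3 * Q) * L)"
        using Tm[of "1 + 2 * Q"] by (simp add: Q0 algebra_simps numeral_eq_Suc)
    qed
    finally have 3: "fps_cong (3 * Q + 3) ((T ^^ p) fps_X) (fps_const (b1 ^ 2) * (fps_X ^ (1 + 3 * Q) * L))"
      by (simp add: True numeral_eq_Suc)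
    have "fps_X ^ (p * q + 3) * (fps_const (0 ^ (p - 3) * b1 ^ 2) * fps_quadratic 0 b1 b2)
        = fps_const (b1 ^ 2) * (fps_X ^ (1 + 3 * Q) * L)"
    proof -
      have "fps_quadratic 0 b1 b2 = fps_X * L"
        by (simp add: fps_quadratic_def L_def power2_eq_square algebra_simps)
      moreover have "1 + 3 * Q = Suc (p * q + 3)" by (simp add: Q_def True)
      moreover have "0 ^ (p - 3) * b1 ^ 2 = b1 ^ 2" by (simp add: True)
      ultimately show ?thesis by (simp only: power_Suc mult_ac)
    qed
    moreover have "3 * Q + 3 = p * q + 6" by (simp add: Q_def True)
    ultimately show ?thesis
      using fps_cong_add[OF fps_cong_refl[of _ fps_X] 3] by (simp only: G)
  qed
qed

lemma iterate_CHAR_step: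
  fixes g :: "'a::field fps"
  assumes p: "prime p" "odd p" "CHAR('a) = p" and q: "q = p * r + 2"
    and g: "fps_cong (q + 4) g (fps_X + fps_X ^ (q + 1) * fps_quadratic b0 b1 b2)"
    and b2': "b2' = b2 - (if q = 2 then 3 / 2 * b0 ^ 2 else 0)"
    and \<mu>: "\<mu> = b0 ^ (p - 3) * (b1 ^ 2 - b0 * b2')"
  shows "fps_cong (p * q + 6) (fps_iterate g p)
           (fps_X + fps_X ^ (p * q + 3) * fps_quadratic (\<mu> * b0) (\<mu> * b1) (\<mu> * b2'))"
proof (cases "b0 = 0")
  case False
  thus ?thesis by (rule iterate_CHAR_step_nonzero[OF p q _ g b2' \<mu>])
next
  case True
  have "b2' = b2" using True by (simp add: b2')
  thus ?thesis
    using iterate_CHAR_step_zero[OF p q g[unfolded True]]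
    by (simp add: True \<mu> fps_quadratic_def algebra_simps flip: fps_const_mult)
qed

section \<open>All iterates of order a power of p\<close>

lemma d_exp_Suc:
  assumes "p \<ge> 2"
  shows "d_exp p (Suc n) = p * d_exp p n + 1"
  using D_exp_altdef[OF assms, of n] by (simp add: d_exp_def D_exp_def)

text \<open>
  Induction by \<^emph>\<open>iterate_CHAR_step\<close>. The first step, with $q = 2$, replaces $a_4$ by
  $b_2 = a_4 - \frac32 a_2^2$. From then on $q = 2D > 2$, there is no further correction, and the triple
  $(a_2, a_3, b_2)$ is only rescaled: a factor $l$ becomes
  $l \cdot (l a_2)^{p-3} l^2 \varphi = l^p a_2^{p-3} \varphi$.
\<close>

lemma iterate_CHAR_power:
  fixes f :: "'a::field fps"
  assumes p: "prime p" "odd p" "CHAR('a) = p"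
    and f: "fps_cong 6 f (fps_X + fps_X ^ 3 * fps_quadratic a2 a3 a4)"
    and b2: "b2 = a4 - 3 / 2 * a2 ^ 2"
    and n: "n \<ge> 1"
    and \<nu>: "\<nu> = a2 ^ (p ^ n - 2 * d_exp p n - 1) * (a3 ^ 2 - a2 * b2) ^ d_exp p n"
  shows "fps_cong (2 * D_exp p n + 4) (fps_iterate f (p ^ n))
           (fps_X + fps_X ^ (2 * D_exp p n + 1) * fps_quadratic (\<nu> * a2) (\<nu> * a3) (\<nu> * b2))"
  using n \<nu>
proof (induction n arbitrary: \<nu> rule: nat_induct_at_least)
  case base
  have p3: "p \<ge> 3" by (rule odd_prime_ge_3[OF p(1,2)])
  hence d: "d_exp p 1 = 1" by (simp add: d_exp_def)
  have "fps_cong (p * 2 + 6) (fps_iterate f p)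
           (fps_X + fps_X ^ (p * 2 + 3) * fps_quadratic (\<nu> * a2) (\<nu> * a3) (\<nu> * b2))"
    by (rule iterate_CHAR_step[OF p, where r = 0]) (use f b2 d in \<open>simp_all add: base\<close>)
  moreover have "p * 2 + 6 = 2 * D_exp p 1 + 4" "p * 2 + 3 = 2 * D_exp p 1 + 1"
    unfolding D_exp_def d by simp_all
  ultimately show ?case by (simp only: power_one_right)
next
  case (Suc n)
  have p3: "p \<ge> 3" by (rule odd_prime_ge_3[OF p(1,2)])
  define \<phi> where "\<phi> = a3 ^ 2 - a2 * b2"
  define d where "d = d_exp p n"
  define E where "E = p ^ n - 2 * d - 1"
  define l where "l = a2 ^ E * \<phi> ^ d"
  have dS: "d_exp p (Suc n) = p * d + 1" using d_exp_Suc[of p n] p3 by (simp add: d_def)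
  have d_pos: "d > 0"
    using \<open>n \<ge> 1\<close> d_exp_Suc[of p "n - 1"] p3 by (simp add: d_def)
  have E: "p ^ n = E + 2 * d + 1"
    using alpha_exponent_pos[OF p3, of n] by (simp add: E_def d_def)
  define q where "q = 2 * D_exp p n"
  have q: "q = p * (2 * d) + 2" by (simp add: q_def D_exp_def d_def)
  have q2: "q \<noteq> 2" using d_pos p3 by (simp add: q)
  have f0: "f $ 0 = 0"
    using f by (auto simp: fps_cong_def dvd_def algebra_simps)
  have IH: "fps_cong (q + 4) (fps_iterate f (p ^ n))
      (fps_X + fps_X ^ (q + 1) * fps_quadratic (l * a2) (l * a3) (l * b2))"
    unfolding q_def by (rule Suc.IH) (simp add: l_def E_def \<phi>_def d_def)
  define \<mu> where "\<mu> = (l * a2) ^ (p - 3) * ((l * a3) ^ 2 - l * a2 * (l * b2))"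
  have step: "fps_cong (p * q + 6) (fps_iterate (fps_iterate f (p ^ n)) p)
      (fps_X + fps_X ^ (p * q + 3) * fps_quadratic (\<mu> * (l * a2)) (\<mu> * (l * a3)) (\<mu> * (l * b2)))"
    by (rule iterate_CHAR_step[OF p q IH]) (simp_all add: q2 \<mu>_def)
  have "\<mu> * l = \<nu>"
  proof -
    have "\<mu> = l ^ (p - 3 + 2) * a2 ^ (p - 3) * \<phi>"
      by (simp add: \<mu>_def \<phi>_def power_mult_distrib power_add power2_eq_square algebra_simps)
    hence "\<mu> * l = l ^ (p - 3 + 3) * a2 ^ (p - 3) * \<phi>"
      by (simp add: power_add eval_nat_numeral mult_ac)
    also have "p - 3 + 3 = p" using p3 by simp
    also have "l ^ p * a2 ^ (p - 3) * \<phi> = a2 ^ (E * p + (p - 3)) * \<phi> ^ (p * d + 1)"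
      by (simp add: l_def power_mult_distrib power_add mult.commute[of p] flip: power_mult)
    also have "E * p + (p - 3) = p ^ Suc n - 2 * (p * d + 1) - 1"
      using p3 by (simp add: E algebra_simps)
    finally show ?thesis by (simp add: Suc.prems dS \<phi>_def)
  qed
  hence \<mu>: "\<mu> * (l * s) = \<nu> * s" for s by (metis mult.assoc)
  have "2 * D_exp p (Suc n) = p * q + 2"
    by (simp add: D_exp_def dS q algebra_simps)
  hence "2 * D_exp p (Suc n) + 4 = p * q + 6" "2 * D_exp p (Suc n) + 1 = p * q + 3"
    by simp_all
  moreover have "fps_iterate f (p ^ Suc n) = fps_iterate (fps_iterate f (p ^ n)) p"
    using fps_iterate_mult[OF f0, of "p ^ n" p] by (simp add: mult.commute)
  ultimately show ?case using step by (simp only: \<mu>)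
qed

theorem theoremB:
  fixes p n :: nat
    and a :: "nat \<Rightarrow> 'a::field"
    and f :: "'a fps"
  assumes "prime p" and "odd p"
    and "CHAR('a) = p"
    and "f = fps_X * (1 + Abs_fps (\<lambda>j. if j \<ge> 2 then a j else 0))"
    and "n \<ge> 1"
  shows "fps_X ^ (2 * D_exp p n + 4) dvd
           (fps_iterate f (p ^ n) - fps_X)
           - (fps_const (alpha p n a) * fps_X ^ (2 * D_exp p n + 1)
              + fps_const (beta p n a) * fps_X ^ (2 * D_exp p n + 2)
              + fps_const (gamma p n a) * fps_X ^ (2 * D_exp p n + 3))"
proof -
  have p3: "p \<ge> 3" by (rule odd_prime_ge_3[OF assms(1,2)])
  have two: "(2::'a) \<noteq> 0" by (rule two_neq_0_CHAR[OF assms(1-3)])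
  define b2 where "b2 = a 4 - 3 / 2 * a 2 ^ 2"
  define \<nu> where "\<nu> = a 2 ^ (p ^ n - 2 * d_exp p n - 1) * phi a ^ d_exp p n"
  have phi: "phi a = a 3 ^ 2 - a 2 * b2"
    by (simp add: phi_def b2_def eval_nat_numeral algebra_simps)
  have alpha: "alpha p n a = \<nu> * a 2"
    by (simp add: alpha_conv[OF p3] \<nu>_def)
  have beta: "beta p n a = \<nu> * a 3"
    by (simp add: beta_def \<nu>_def)
  have "gamma p n a = - (3 * a 2 / 2 * (\<nu> * a 2) - a 4 * \<nu>)"
    by (simp only: gamma_def alpha \<nu>_def)
  also have "\<dots> = \<nu> * b2"
    using two by (simp add: b2_def power2_eq_square field_simps)
  finally have gamma: "gamma p n a = \<nu> * b2" .
  have f: "fps_cong 6 f (fps_X + fps_X ^ 3 * fps_quadratic (a 2) (a 3) (a 4))"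
  proof -
    define S where "S = Abs_fps (\<lambda>j. if j \<ge> 2 then a j else 0)"
    have "S = fps_X ^ 2 * fps_quadratic (a 2) (a 3) (a 4) + fps_X ^ 5 * fps_shift 5 S"
    proof (rule fps_ext)
      fix j :: nat
      consider "j = 0" | "j = 1" | "j = 2" | "j = 3" | "j = 4" | "j \<ge> 5" by linarith
      thus "S $ j = (fps_X ^ 2 * fps_quadratic (a 2) (a 3) (a 4) + fps_X ^ 5 * fps_shift 5 S) $ j"
        by cases (auto simp: S_def fps_quadratic_def fps_X_power_mult_nth fps_X_power_nth)
    qed
    hence "f = fps_X * (1 + (fps_X ^ 2 * fps_quadratic (a 2) (a 3) (a 4) + fps_X ^ 5 * fps_shift 5 S))"
      using assms(4) by (simp flip: S_def)
    hence "f - (fps_X + fps_X ^ 3 * fps_quadratic (a 2) (a 3) (a 4)) = fps_X ^ 6 * fps_shift 5 S"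
      by (simp add: eval_nat_numeral algebra_simps)
    thus ?thesis by (simp add: fps_cong_def)
  qed
  have "fps_cong (2 * D_exp p n + 4) (fps_iterate f (p ^ n))
      (fps_X + fps_X ^ (2 * D_exp p n + 1) * fps_quadratic (\<nu> * a 2) (\<nu> * a 3) (\<nu> * b2))"
    by (rule iterate_CHAR_power[OF assms(1-3) f b2_def assms(5)]) (simp add: \<nu>_def phi)
  thus ?thesis
    by (simp add: fps_cong_def fps_quadratic_def alpha beta gamma algebra_simps eval_nat_numeral)
qed

end
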